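(* Let $G$ be a weird $\mathbb R$-factorizable group, that is, an $\mathbb R$-factorizable topological group which is not pseudo-$\aleph_1$-compact. Then (1) the topological group $G\times G$ is not $\mathbb R$-factorizable; (2) there exists a surjective continuous homomorphism of $G$ onto a topological group which is not $\mathbb R$-factorizable; (3) $w(G)>\omega_1$; (4) $w(G)^\omega\geq 2^{\omega_1}$; (5) $\psi(G)\leq\omega$, that is, $G$ is submetrizable; (6) if $H$ is a topological group and the topological group $G\times H$ is $\mathbb R$-factorizable, then (a) $H^\omega$ is hereditarily Lindelöf and hereditarily separable; (b) if $w(H)\leq \omega_1$, then $H$ is second-countable; (c) under $\mathrm{CH}$ (the continuum hypothesis), $H$ is second-countable.
   Context: All topological spaces and topological groups are assumed to be Tychonoff (including Hausdorff). A topological group $G$ is $\mathbb R$-factorizable if for any continuous function $f\colon G\to\mathbb R$ there exist a second-countable topological group $H$, a continuous homomorphism $h\colon G\to H$, and a continuous function $g\colon H\to\mathbb R$ such that $f=g\circ h$. A space is pseudo-$\aleph_1$-compact if any locally finite (equivalently, any discrete) family of open sets in it is at most countable. $w(X)$ denotes the weight of a space $X$, and $\psi(X)$ its pseudocharacter (the least cardinal $\kappa$ such that every point of $X$ is the intersection of at most $\kappa$ many of its neighborhoods). A space is submetrizable if it admits a coarser metrizable topology. The power $H^\omega$ carries the product topology. *)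

theory Defs
  imports "HOL-Analysis.Analysis" "HOL-Algebra.Group"
begin

unbundle cardinal_syntax

section \<open>Topological groups\<close>

definition topological_group :: "('a, 'm) monoid_scheme \<Rightarrow> 'a topology \<Rightarrow> bool" where
  "topological_group G T \<longleftrightarrow>
     group G \<and> topspace T = carrier G \<and>
     continuous_map (prod_topology T T) T (\<lambda>(x, y). x \<otimes>\<^bsub>G\<^esub> y) \<and>
     continuous_map T T (\<lambda>x. inv\<^bsub>G\<^esub> x) \<and>
     Hausdorff_space T \<and> completely_regular_space T"

text \<open>
  The group \<open>H\<close> in the definition of \<open>\<real>\<close>-factorizability ranges over all second-countable
  topological groups. These have cardinality at most continuum, so it suffices to let \<open>H\<close> range
  over those whose elements are real numbers; \<open>r_factorizable_anyI\<close> below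
  shows that no generality is lost.
\<close>

definition factors_through ::
    "('a, 'm) monoid_scheme \<Rightarrow> 'a topology \<Rightarrow> ('a \<Rightarrow> real) \<Rightarrow> ('b, 'n) monoid_scheme \<Rightarrow> 'b topology \<Rightarrow> bool" where
  "factors_through G T f H TH \<longleftrightarrow>
     (\<exists>h g. h \<in> hom G H \<and> continuous_map T TH h \<and> continuous_map TH euclideanreal g \<and>
            (\<forall>x \<in> carrier G. f x = g (h x)))"

definition r_factorizable :: "('a, 'm) monoid_scheme \<Rightarrow> 'a topology \<Rightarrow> bool" where
  "r_factorizable G T \<longleftrightarrow>
     (\<forall>f. continuous_map T euclideanreal f \<longrightarrow>
        (\<exists>(H :: real monoid) TH. topological_group H TH \<and> second_countable TH \<and>
           factors_through G T f H TH))"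

definition pseudo_aleph1_compact :: "'a topology \<Rightarrow> bool" where
  "pseudo_aleph1_compact X \<longleftrightarrow>
     (\<forall>\<U>. (\<forall>U \<in> \<U>. openin X U) \<and> locally_finite_in X \<U> \<longrightarrow> countable \<U>)"

definition weird_r_factorizable :: "('a, 'm) monoid_scheme \<Rightarrow> 'a topology \<Rightarrow> bool" where
  "weird_r_factorizable G T \<longleftrightarrow>
     topological_group G T \<and> r_factorizable G T \<and> \<not> pseudo_aleph1_compact T"

definition submetrizable :: "'a topology \<Rightarrow> bool" where
  "submetrizable X \<longleftrightarrow>
     (\<exists>Y. metrizable_space Y \<and> topspace Y = topspace X \<and> (\<forall>U. openin Y U \<longrightarrow> openin X U))"


section \<open>Cardinal functions\<close>

abbreviation omega1 :: "nat set rel" where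
  "omega1 \<equiv> cardSuc natLeq"

definition continuum_hypothesis :: bool where
  "continuum_hypothesis \<longleftrightarrow> |UNIV :: real set| =o omega1"

definition is_base :: "'a topology \<Rightarrow> 'a set set \<Rightarrow> bool" where
  "is_base X \<B> \<longleftrightarrow>
     (\<forall>V \<in> \<B>. openin X V) \<and> (\<forall>U x. openin X U \<and> x \<in> U \<longrightarrow> (\<exists>V \<in> \<B>. x \<in> V \<and> V \<subseteq> U))"

text \<open>
  The choice operator picks a witness of least cardinality; see \<open>weight_attained\<close>,
  \<open>weight_le\<close> and \<open>pseudocharacter_le_iff\<close> below.
\<close>

definition weight :: "'a topology \<Rightarrow> 'a set rel" where
  "weight X = |SOME \<B>. is_base X \<B> \<and> (\<forall>\<B>'. is_base X \<B>' \<longrightarrow> |\<B>| \<le>o |\<B>'| )|"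

text \<open>
  Intersecting with the whole space only matters for the empty family, whose intersection
  is to be read as the whole space.
\<close>

definition points_are_intersections :: "'a topology \<Rightarrow> 'k rel \<Rightarrow> bool" where
  "points_are_intersections X \<kappa> \<longleftrightarrow>
     (\<forall>x \<in> topspace X. \<exists>\<N>. |\<N>| \<le>o \<kappa> \<and> (\<forall>U \<in> \<N>. openin X U \<and> x \<in> U) \<and>
        topspace X \<inter> \<Inter>\<N> = {x})"

definition pseudocharacter :: "'a topology \<Rightarrow> 'a set rel" where
  "pseudocharacter X =
     |SOME K :: 'a set set. points_are_intersections X |K| \<and>
        (\<forall>K' :: 'a set set. points_are_intersections X |K'| \<longrightarrow> |K| \<le>o |K'| )|"


section \<open>Adequacy of the definitions\<close>

lemma ex_least_card_of:
  fixes P :: "'k set \<Rightarrow> bool"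
  assumes "P A"
  shows "\<exists>B. P B \<and> (\<forall>B'. P B' \<longrightarrow> |B| \<le>o |B'| )"
proof -
  let ?R = "card_of ` {B. P B}"
  have "?R \<noteq> {}" "\<forall>r\<in>?R. Card_order r"
    using assms card_of_Card_order by auto
  then obtain r where "r \<in> ?R" "\<forall>r'\<in>?R. r \<le>o r'"
    using exists_minim_Card_order[of ?R] by blast
  then show ?thesis by blast
qed

lemma is_base_openin: "is_base X {U. openin X U}"
  by (auto simp: is_base_def)

lemma weight_attained_le:
  "\<exists>\<B>. is_base X \<B> \<and> weight X = |\<B>| \<and> (\<forall>\<B>'. is_base X \<B>' \<longrightarrow> |\<B>| \<le>o |\<B>'| )"
proof -
  let ?P = "\<lambda>\<B>. is_base X \<B> \<and> (\<forall>\<B>'. is_base X \<B>' \<longrightarrow> |\<B>| \<le>o |\<B>'| )"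
  have "?P (SOME \<B>. ?P \<B>)"
    by (rule someI_ex[OF ex_least_card_of[of "is_base X", OF is_base_openin]])
  then show ?thesis
    unfolding weight_def by (intro exI[of _ "SOME \<B>. ?P \<B>"]) simp
qed

lemma weight_attained: "\<exists>\<B>. is_base X \<B> \<and> weight X = |\<B>|"
  using weight_attained_le by blast

lemma weight_le: "is_base X \<B> \<Longrightarrow> weight X \<le>o |\<B>|"
  using weight_attained_le by metis

lemma points_are_intersections_mono:
  "points_are_intersections X r \<Longrightarrow> r \<le>o s \<Longrightarrow> points_are_intersections X s"
  unfolding points_are_intersections_def using ordLeq_transitive by blast

lemma points_are_intersections_UNIV:
  fixes X :: "'a topology"
  assumes "t1_space X"
  shows "points_are_intersections X |UNIV :: 'a set set|"
  unfolding points_are_intersections_def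
proof
  fix x assume x: "x \<in> topspace X"
  let ?N = "{U. openin X U \<and> x \<in> U}"
  have "topspace X \<inter> \<Inter>?N = {x}"
  proof (intro equalityI subsetI)
    fix y assume y: "y \<in> topspace X \<inter> \<Inter>?N"
    show "y \<in> {x}"
    proof (rule ccontr)
      assume "y \<notin> {x}"
      then obtain U where "openin X U" "x \<in> U" "y \<notin> U"
        using assms x y unfolding t1_space_def by (metis IntD1 singletonI)
      then show False using y by auto
    qed
  qed (use x in auto)
  then show "\<exists>\<N>. |\<N>| \<le>o |UNIV :: 'a set set| \<and> (\<forall>U\<in>\<N>. openin X U \<and> x \<in> U) \<and>
      topspace X \<inter> \<Inter>\<N> = {x}"
    by (intro exI[of _ ?N]) (auto simp: card_of_mono1)
qed

lemma pseudocharacter_le_iff: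
  fixes X :: "'a topology" and r :: "'k rel"
  assumes X: "t1_space X" and r: "Card_order r"
  shows "pseudocharacter X \<le>o r \<longleftrightarrow> points_are_intersections X r"
proof -
  let ?P = "\<lambda>K :: 'a set set. points_are_intersections X |K|"
  obtain K where K: "?P K" "pseudocharacter X = |K|"
    and least: "\<And>K'. ?P K' \<Longrightarrow> |K| \<le>o |K'|"
    using someI_ex[OF ex_least_card_of[of ?P, OF points_are_intersections_UNIV[OF X]]]
    unfolding pseudocharacter_def by blast
  show ?thesis
  proof
    assume "pseudocharacter X \<le>o r"
    then show "points_are_intersections X r"
      using K points_are_intersections_mono by metis
  next
    assume P: "points_are_intersections X r"
    consider "|UNIV :: 'a set set| \<le>o r" | "r \<le>o |UNIV :: 'a set set|"
      using r ordLeq_total card_of_Well_order unfolding card_order_on_def by blast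
    then show "pseudocharacter X \<le>o r"
    proof cases
      case 1
      then show ?thesis
        using K least[OF points_are_intersections_UNIV[OF X]] ordLeq_transitive by metis
    next
      case 2
      have "|Field r| =o r" using r card_of_Field_ordIso by blast
      moreover from 2 this have "|Field r| \<le>o |UNIV :: 'a set set|"
        using ordIso_ordLeq_trans by blast
      then obtain f :: "'k \<Rightarrow> 'a set" where f: "inj_on f (Field r)"
        using card_of_ordLeq[of "Field r" "UNIV :: 'a set set"] by blast
      then have "|Field r| =o |f ` Field r|"
        using card_of_ordIso inj_on_imp_bij_betw by blast
      ultimately have r_iso: "r =o |f ` Field r|"
        using ordIso_symmetric ordIso_transitive by blast
      then have "?P (f ` Field r)"
        using P points_are_intersections_mono ordIso_imp_ordLeq by blast
      then show ?thesis
        using K(2) least r_iso ordIso_symmetric ordLeq_ordIso_trans by metis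
    qed
  qed
qed

lemma topological_group_transport:
  fixes H :: "('b, 'n) monoid_scheme" and \<phi> :: "'b \<Rightarrow> 'c"
  assumes H: "topological_group H TH" and inj: "inj_on \<phi> (carrier H)"
  shows "\<exists>(K :: 'c monoid) TK. topological_group K TK \<and> \<phi> \<in> iso H K \<and> homeomorphic_map TH TK \<phi>"
proof -
  interpret H: group H using H by (simp add: topological_group_def)
  have top: "topspace TH = carrier H" using H by (simp add: topological_group_def)
  define \<psi> where "\<psi> = inv_into (carrier H) \<phi>"
  define C where "C = \<phi> ` carrier H"
  have \<psi>\<phi>: "\<psi> (\<phi> x) = x" if "x \<in> carrier H" for x
    using that inj by (simp add: \<psi>_def)
  have \<phi>\<psi>: "\<phi> (\<psi> y) = y" "\<psi> y \<in> carrier H" if "y \<in> C" for y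
    using that by (auto simp: C_def \<psi>\<phi>)
  define K :: "'c monoid" where
    "K = \<lparr>carrier = C, monoid.mult = (\<lambda>x y. \<phi> (\<psi> x \<otimes>\<^bsub>H\<^esub> \<psi> y)), one = \<phi> \<one>\<^bsub>H\<^esub>\<rparr>"
  have K: "carrier K = C" "\<And>x y. x \<otimes>\<^bsub>K\<^esub> y = \<phi> (\<psi> x \<otimes>\<^bsub>H\<^esub> \<psi> y)" "\<one>\<^bsub>K\<^esub> = \<phi> \<one>\<^bsub>H\<^esub>"
    by (simp_all add: K_def)
  have \<phi>C: "\<phi> x \<in> C" if "x \<in> carrier H" for x using that by (simp add: C_def)
  have gK: "group K"
  proof (rule groupI)
    fix x assume "x \<in> carrier K"
    then have x: "x \<in> C" by (simp add: K)
    show "\<exists>y\<in>carrier K. y \<otimes>\<^bsub>K\<^esub> x = \<one>\<^bsub>K\<^esub>"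
      by (rule bexI[of _ "\<phi> (inv\<^bsub>H\<^esub> (\<psi> x))"]) (use x in \<open>simp_all add: K \<phi>\<psi> \<psi>\<phi> \<phi>C\<close>)
  qed (auto simp: K \<phi>\<psi> \<psi>\<phi> \<phi>C H.m_assoc)
  have iso: "\<phi> \<in> iso H K"
    using inj by (auto simp: iso_def hom_def bij_betw_def K C_def \<psi>\<phi>)
  have inv: "inv\<^bsub>K\<^esub> y = \<phi> (inv\<^bsub>H\<^esub> (\<psi> y))" if "y \<in> C" for y
    by (rule group.inv_equality[OF gK]) (use that in \<open>simp_all add: K \<phi>\<psi> \<psi>\<phi> \<phi>C\<close>)
  define TK where "TK = pullback_topology C \<psi> TH"
  have topK: "topspace TK = C"
    by (auto simp: TK_def topspace_pullback_topology top \<phi>\<psi>)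
  have c\<psi>: "continuous_map TK TH \<psi>"
    using continuous_map_pullback[of TH TH id C \<psi>] by (simp add: TK_def)
  have c\<phi>: "continuous_map TH TK \<phi>"
    unfolding TK_def
  proof (rule continuous_map_pullback')
    show "continuous_map TH TH (\<psi> \<circ> \<phi>)"
      using continuous_map_eq[of TH TH id "\<psi> \<circ> \<phi>"] by (simp add: top \<psi>\<phi>)
    show "topspace TH \<subseteq> \<phi> -` C"
      by (auto simp: top \<phi>C)
  qed
  have "homeomorphic_maps TH TK \<phi> \<psi>"
    using c\<phi> c\<psi> by (simp add: homeomorphic_maps_def top topK \<phi>\<psi> \<psi>\<phi>)
  then have homeo: "homeomorphic_map TH TK \<phi>" and "TH homeomorphic_space TK"
    by (auto simp: homeomorphic_map_maps homeomorphic_space_def)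
  then have "Hausdorff_space TK" "completely_regular_space TK"
    using H homeomorphic_Hausdorff_space homeomorphic_completely_regular_space
    unfolding topological_group_def by blast+
  moreover have "continuous_map (prod_topology TK TK) TK (\<lambda>(x, y). x \<otimes>\<^bsub>K\<^esub> y)"
  proof -
    have "continuous_map (prod_topology TK TK) (prod_topology TH TH) (\<lambda>(x, y). (\<psi> x, \<psi> y))"
      using c\<psi> by (subst continuous_map_prod_top) auto
    moreover have "continuous_map (prod_topology TH TH) TH (\<lambda>(x, y). x \<otimes>\<^bsub>H\<^esub> y)"
      using H by (simp add: topological_group_def)
    ultimately have "continuous_map (prod_topology TK TK) TK
        (\<phi> \<circ> ((\<lambda>(x, y). x \<otimes>\<^bsub>H\<^esub> y) \<circ> (\<lambda>(x, y). (\<psi> x, \<psi> y))))"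
      by (rule continuous_map_compose[OF continuous_map_compose c\<phi>])
    then show ?thesis
      by (simp add: K comp_def case_prod_unfold)
  qed
  moreover have "continuous_map TK TK (\<lambda>x. inv\<^bsub>K\<^esub> x)"
  proof (rule continuous_map_eq)
    have "continuous_map TH TH (\<lambda>x. inv\<^bsub>H\<^esub> x)"
      using H by (simp add: topological_group_def)
    then show "continuous_map TK TK (\<phi> \<circ> ((\<lambda>x. inv\<^bsub>H\<^esub> x) \<circ> \<psi>))"
      using continuous_map_compose[OF continuous_map_compose[OF c\<psi>] c\<phi>] by simp
  qed (simp add: topK inv)
  ultimately have "topological_group K TK"
    using gK by (simp add: topological_group_def topK K)
  then show ?thesis using iso homeo by blast
qed

lemma second_countable_lepoll_real:
  assumes "second_countable X" "t0_space X"
  shows "topspace X \<lesssim> (UNIV :: real set)"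
proof -
  obtain \<B> where \<B>: "countable \<B>" "\<And>V. V \<in> \<B> \<Longrightarrow> openin X V"
    "\<And>U x. openin X U \<Longrightarrow> x \<in> U \<Longrightarrow> \<exists>V \<in> \<B>. x \<in> V \<and> V \<subseteq> U"
    using assms(1) unfolding second_countable_def by metis
  define e where "e = (\<lambda>x. to_nat_on \<B> ` {V \<in> \<B>. x \<in> V})"
  have "inj_on e (topspace X)"
  proof (rule inj_onI, rule ccontr)
    fix x y assume xy: "x \<in> topspace X" "y \<in> topspace X" "e x = e y" "x \<noteq> y"
    have "{V \<in> \<B>. x \<in> V} = {V \<in> \<B>. y \<in> V}"
      using inj_on_image_eq_iff[OF inj_on_to_nat_on[OF \<B>(1)], of "{V \<in> \<B>. x \<in> V}" "{V \<in> \<B>. y \<in> V}"]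
        xy(3) unfolding e_def by blast
    moreover obtain U where "openin X U" "x \<notin> U \<longleftrightarrow> y \<in> U"
      using assms(2) xy unfolding t0_space_def by blast
    ultimately show False using \<B>(3) by blast
  qed
  then have "topspace X \<lesssim> (UNIV :: nat set set)"
    unfolding lepoll_def by blast
  then show ?thesis
    using nat_sets_eqpoll_reals lepoll_trans2 by blast
qed

theorem r_factorizable_anyI:
  fixes G :: "('a, 'm) monoid_scheme"
  assumes any: "\<And>f. continuous_map T euclideanreal f \<Longrightarrow>
      \<exists>(H :: 'b monoid) TH. topological_group H TH \<and> second_countable TH \<and> factors_through G T f H TH"
  shows "r_factorizable G T"
  unfolding r_factorizable_def
proof (intro allI impI)
  fix f assume "continuous_map T euclideanreal f"
  then obtain H :: "'b monoid" and TH h g where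
    H: "topological_group H TH" "second_countable TH" and
    h: "h \<in> hom G H" "continuous_map T TH h" and
    g: "continuous_map TH euclideanreal g" "\<forall>x \<in> carrier G. f x = g (h x)"
    using any[of f] unfolding factors_through_def by blast
  have "carrier H \<lesssim> (UNIV :: real set)"
    using second_countable_lepoll_real[of TH] H Hausdorff_imp_t0_space
    by (metis topological_group_def)
  then obtain \<phi> :: "'b \<Rightarrow> real" where "inj_on \<phi> (carrier H)"
    unfolding lepoll_def by blast
  then obtain K :: "real monoid" and TK where
    K: "topological_group K TK" "\<phi> \<in> iso H K" "homeomorphic_map TH TK \<phi>"
    using topological_group_transport[OF H(1)] by blast
  then obtain \<psi> where \<psi>: "homeomorphic_maps TH TK \<phi> \<psi>"
    using homeomorphic_map_maps by blast
  have "second_countable TK"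
    using H(2) \<psi> homeomorphic_space_def homeomorphic_space_second_countability by blast
  moreover have "factors_through G T f K TK"
    unfolding factors_through_def
  proof (intro exI conjI ballI)
    show "\<phi> \<circ> h \<in> hom G K"
      using h(1) K(2) hom_compose by (auto simp: iso_def)
    show "continuous_map T TK (\<phi> \<circ> h)" "continuous_map TK euclideanreal (g \<circ> \<psi>)"
      using \<psi> h(2) g(1) continuous_map_compose unfolding homeomorphic_maps_def by blast+
    fix x assume x: "x \<in> carrier G"
    then have "h x \<in> topspace TH"
      using h(1) H(1) by (auto simp: hom_def topological_group_def)
    then show "f x = (g \<circ> \<psi>) ((\<phi> \<circ> h) x)"
      using \<psi> g(2) x by (simp add: homeomorphic_maps_def)
  qed
  ultimately show "\<exists>(H :: real monoid) TH.
      topological_group H TH \<and> second_countable TH \<and> factors_through G T f H TH"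
    using K(1) by blast
qed

end

theory Submission
  imports Defs "HOL-Algebra.Free_Abelian_Groups" "HOL-Library.Countable_Set_Type"
begin

text \<open>
  Since \<open>G\<close> is not pseudo-\<open>\<aleph>\<^sub>1\<close>-compact, there are points \<open>p\<^sub>\<alpha>\<close> (\<open>\<alpha> < \<omega>\<^sub>1\<close>) with disjoint, locally
  finite open neighbourhoods \<open>U\<^sub>\<alpha>\<close>, and arbitrary continuous functions vanishing off the \<open>U\<^sub>\<alpha>\<close> can be
  glued to one continuous function \<open>F\<close>. By \<open>\<real>\<close>-factorizability, \<open>F\<close> is continuous for a second-countable
  group topology coarser than that of \<open>G\<close>, and a second-countable space has no family
  of \<open>\<omega>\<^sub>1\<close> points \<open>y\<^sub>\<alpha>\<close> with neighbourhoods \<open>V\<^sub>\<alpha>\<close> such that \<open>y\<^sub>\<beta> \<notin> V\<^sub>\<alpha>\<close> or \<open>y\<^sub>\<alpha> \<notin> V\<^sub>\<beta>\<close> whenever \<open>\<alpha> \<noteq> \<beta>\<close>.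
  For (5), if the identity is not a \<open>G\<^sub>\<delta>\<close>, such a family is built by recursion, with \<open>F\<close> near \<open>p\<^sub>\<alpha>\<close>
  a translate of a function separating \<open>y\<^sub>\<alpha>\<close> from the later \<open>y\<^sub>\<beta>\<close>. For (3), a group of weight \<open>\<omega>\<^sub>1\<close> is
  exhausted by \<open>\<omega>\<^sub>1\<close> second-countable group topologies, and \<open>F\<close> near \<open>p\<^sub>\<alpha>\<close> is chosen to be discontinuous
  for the \<open>\<alpha>\<close>-th one. (2) follows by applying (3) to a coarser group topology of weight \<open>\<omega>\<^sub>1\<close>, and
  (4) by counting the \<open>2\<^bsup>\<omega>\<^sub>1\<^esup>\<close> sums of bump functions. In (1) and (6), glueing \<open>\<omega>\<^sub>1\<close> functions on \<open>H\<close>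
  along the \<open>U\<^sub>\<alpha>\<close> makes them all continuous for a single second-countable topology on \<open>H\<close>.
\<close>

section \<open>The first uncountable cardinal and locally finite families\<close>

lemma uncountable_Field_omega1: "uncountable (Field omega1)"
proof
  assume "countable (Field omega1)"
  then have "|Field omega1| \<le>o natLeq"
    by (simp add: countable_card_le_natLeq)
  then have "omega1 \<le>o natLeq"
    using card_of_Field_ordIso[OF cardSuc_Card_order[OF natLeq_Card_order]] ordIso_symmetric
      ordIso_ordLeq_trans by blast
  then show False
    using cardSuc_greater[OF natLeq_Card_order] not_ordLess_ordLeq by blast
qed

lemma Card_order_omega1: "Card_order omega1"
  by (rule cardSuc_Card_order[OF natLeq_Card_order])

lemma Well_order_omega1: "Well_order omega1"
  by (rule cardSuc_Well_order[OF natLeq_Card_order])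

lemma card_of_Field_omega1: "|Field omega1| =o omega1"
  by (rule card_of_Field_ordIso[OF Card_order_omega1])

lemma infinite_Field_omega1: "infinite (Field omega1)"
  using uncountable_Field_omega1 countable_finite by blast

lemma natLeq_le_omega1: "natLeq \<le>o omega1"
  by (rule ordLess_imp_ordLeq[OF cardSuc_greater[OF natLeq_Card_order]])

lemma countable_imp_le_omega1: "countable A \<Longrightarrow> |A| \<le>o omega1"
  unfolding countable_card_le_natLeq by (rule ordLeq_transitive[OF _ natLeq_le_omega1])

lemma card_of_Times_le_omega1: "|A| \<le>o omega1 \<Longrightarrow> |B| \<le>o omega1 \<Longrightarrow> |A \<times> B| \<le>o omega1"
  by (rule card_of_Times_ordLeq_infinite_Field[OF infinite_Field_omega1 _ _ Card_order_omega1])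

text \<open>The finite subsets of \<open>\<F> \<times> UNIV\<close> index a base of the initial
  topology built from \<open>\<F>\<close> below; this bounds the size of that base.\<close>

lemma card_of_Fpow_times_nat_le_omega1:
  assumes "|\<F>| \<le>o omega1"
  shows "|Fpow (\<F> \<times> (UNIV :: nat set))| \<le>o omega1"
proof (cases "finite (\<F> \<times> (UNIV :: nat set))")
  case True
  then show ?thesis by (intro countable_imp_le_omega1 countable_Fpow countable_finite)
next
  case False
  have "|\<F> \<times> (UNIV :: nat set)| \<le>o omega1"
    by (rule card_of_Times_le_omega1[OF assms countable_imp_le_omega1]) simp
  then show ?thesis
    using card_of_Fpow_infinite[OF False] ordIso_ordLeq_trans by blast
qed

lemma omega1_less_iff_not_le: "omega1 <o |A| \<longleftrightarrow> \<not> |A| \<le>o omega1"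
  using not_ordLeq_iff_ordLess[OF Well_order_omega1 card_of_Well_order] by blast

lemma countable_underS_omega1: "countable (underS omega1 a)"
proof (cases "a \<in> Field omega1")
  case True
  then have "|underS omega1 a| <o omega1"
    by (rule card_of_underS[OF Card_order_omega1])
  then show ?thesis
    unfolding countable_card_le_natLeq
    by (rule iffD1[OF cardSuc_ordLeq_ordLess[OF natLeq_Card_order card_of_Card_order]])
qed (simp add: underS_empty)

lemma wf_omega1: "wf (omega1 - Id)"
  using Well_order_omega1 by (simp add: well_order_on_def)

lemma underS_omega1_subset: "underS omega1 a \<subseteq> Field omega1"
  by (auto simp: underS_def Field_def)

lemma underS_omega1_total:
  "\<lbrakk>a \<in> Field omega1; b \<in> Field omega1; a \<noteq> b\<rbrakk> \<Longrightarrow> a \<in> underS omega1 b \<or> b \<in> underS omega1 a"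
  using Well_order_omega1 unfolding well_order_on_def linear_order_on_def total_on_def underS_def
  by blast

text \<open>Regularity of \<open>omega1\<close>: a countable set without a strict upper bound would
  cover the whole field by countably many countable initial segments.\<close>

lemma countable_bounded_omega1:
  assumes A: "countable A" "A \<subseteq> Field omega1"
  shows "\<exists>a \<in> Field omega1. A \<subseteq> underS omega1 a"
proof (rule ccontr)
  assume "\<not> ?thesis"
  then have n: "\<forall>a \<in> Field omega1. \<exists>b \<in> A. b \<notin> underS omega1 a" by blast
  have "Field omega1 \<subseteq> (\<Union>b\<in>A. insert b (underS omega1 b))"
  proof (intro subsetI)
    fix a assume a: "a \<in> Field omega1"
    then obtain b where b: "b \<in> A" "b \<notin> underS omega1 a" using n by blast
    then have "a = b \<or> a \<in> underS omega1 b"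
      using underS_omega1_total[OF a, of b] A(2) by blast
    then show "a \<in> (\<Union>b\<in>A. insert b (underS omega1 b))" using b(1) by blast
  qed
  moreover have "countable (\<Union>b\<in>A. insert b (underS omega1 b))"
    by (intro countable_UN A(1) countable_insert countable_underS_omega1)
  ultimately show False
    using uncountable_Field_omega1 countable_subset by blast
qed

lemma omega1_inj_into_uncountable:
  assumes "uncountable A"
  shows "\<exists>f. inj_on f (Field omega1) \<and> f ` Field omega1 \<subseteq> A"
proof -
  have "\<not> |A| \<le>o natLeq" using assms by (simp add: countable_card_le_natLeq)
  then have "natLeq <o |A|"
    using not_ordLeq_iff_ordLess natLeq_Well_order card_of_Well_order by blast
  then have "omega1 \<le>o |A|"
    using cardSuc_ordLess_ordLeq[OF natLeq_Card_order card_of_Card_order] by blast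
  then have "|Field omega1| \<le>o |A|"
    using card_of_Field_omega1 ordIso_ordLeq_trans by blast
  then show ?thesis by (simp add: card_of_ordLeq[symmetric])
qed

lemma omega1_enumerates:
  assumes "|A| \<le>o omega1" "A \<noteq> {}"
  shows "\<exists>f. f ` Field omega1 = A"
proof -
  have "|A| \<le>o |Field omega1|"
    using assms(1) card_of_Field_omega1 ordIso_symmetric ordLeq_ordIso_trans by blast
  then show ?thesis using card_of_ordLeq2[OF assms(2)] by blast
qed

text \<open>A basic neighbourhood of \<open>y a\<close> inside \<open>V a\<close> determines
  \<open>a\<close>: if two indices shared it, each of their points would lie in both open
  sets.\<close>

lemma second_countable_separated_imp_countable:
  assumes "second_countable Z"
    and "\<And>a. a \<in> W \<Longrightarrow> openin Z (V a) \<and> y a \<in> V a"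
    and "\<And>a b. a \<in> W \<Longrightarrow> b \<in> W \<Longrightarrow> a \<noteq> b \<Longrightarrow> y a \<notin> V b \<or> y b \<notin> V a"
  shows "countable W"
proof -
  obtain \<B> where \<B>: "countable \<B>"
    "\<And>U x. openin Z U \<Longrightarrow> x \<in> U \<Longrightarrow> \<exists>V \<in> \<B>. x \<in> V \<and> V \<subseteq> U"
    using assms(1) unfolding second_countable_def by metis
  have "\<forall>a\<in>W. \<exists>B\<in>\<B>. y a \<in> B \<and> B \<subseteq> V a" using \<B>(2) assms(2) by blast
  then obtain b where b: "\<And>a. a \<in> W \<Longrightarrow> b a \<in> \<B> \<and> y a \<in> b a \<and> b a \<subseteq> V a" by metis
  have "inj_on b W"
    by (rule inj_onI) (metis assms(3) b subsetD)
  moreover have "countable (b ` W)" using b \<B>(1) countable_subset by (metis image_subsetI)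
  ultimately show ?thesis using countable_image_inj_on by blast
qed

section \<open>Bump functions, disjoint locally finite families and glueing\<close>

lemma completely_regular_bump:
  assumes "completely_regular_space X" "openin X V" "x \<in> V"
  shows "\<exists>f. continuous_map X euclideanreal f \<and> f x = 1 \<and> (\<forall>y \<in> topspace X - V. f y = 0)"
proof -
  have "\<exists>f. continuous_map X euclideanreal f \<and> f x = 1 \<and> f ` (topspace X - V) \<subseteq> {0}"
    using assms completely_regular_space_gen_alt'[of 1 0 X] by simp
  then show ?thesis by (fastforce simp: image_subset_iff)
qed

lemma openin_superlevel:
  "continuous_map X euclideanreal f \<Longrightarrow> openin X {x \<in> topspace X. f x > c}"
  using openin_continuous_map_preimage[of X euclideanreal f "{c<..}"] by simp

lemma openin_sublevel:
  "continuous_map X euclideanreal f \<Longrightarrow> openin X {x \<in> topspace X. f x < c}"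
  using openin_continuous_map_preimage[of X euclideanreal f "{..<c}"] by simp

text \<open>Families are indexed, and local finiteness counts indices, so that a point and a
  function can be attached to each \<open>a\<close>.\<close>

definition disjoint_locally_finite :: "'a topology \<Rightarrow> 'i set \<Rightarrow> ('i \<Rightarrow> 'a set) \<Rightarrow> bool" where
  "disjoint_locally_finite X W U \<longleftrightarrow>
     (\<forall>a\<in>W. openin X (U a)) \<and> disjoint_family_on U W \<and>
     (\<forall>x\<in>topspace X. \<exists>V. openin X V \<and> x \<in> V \<and> finite {a \<in> W. U a \<inter> V \<noteq> {}})"

lemma disjoint_locally_finiteD:
  assumes "disjoint_locally_finite X W U"
  shows "a \<in> W \<Longrightarrow> openin X (U a)" "disjoint_family_on U W"
  using assms by (auto simp: disjoint_locally_finite_def)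

text \<open>Zorn gives a maximal independent set \<open>M\<close> of the graph \<open>E\<close>. By
  maximality every vertex lies in \<open>M\<close> or is adjacent to a member of \<open>M\<close>;
  as degrees are finite, a countable \<open>M\<close> would make \<open>A\<close> countable.\<close>

lemma finite_degree_imp_uncountable_independent:
  assumes unc: "uncountable A" and deg: "\<And>a. a \<in> A \<Longrightarrow> finite {b \<in> A. E a b}"
    and sym: "\<And>a b. E a b \<Longrightarrow> E b a"
  shows "\<exists>M \<subseteq> A. uncountable M \<and> (\<forall>a\<in>M. \<forall>b\<in>M. a \<noteq> b \<longrightarrow> \<not> E a b)"
proof -
  let ?I = "{M. M \<subseteq> A \<and> (\<forall>a\<in>M. \<forall>b\<in>M. a \<noteq> b \<longrightarrow> \<not> E a b)}"
  have "\<exists>M\<in>?I. \<forall>X\<in>?I. M \<subseteq> X \<longrightarrow> X = M"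
  proof (rule subset_Zorn)
    fix C assume C: "subset.chain ?I C"
    have "\<Union>C \<in> ?I"
    proof (intro CollectI conjI ballI impI)
      show "\<Union>C \<subseteq> A" using C by (auto simp: subset_chain_def)
      fix a b assume "a \<in> \<Union>C" "b \<in> \<Union>C" "a \<noteq> b"
      then obtain X Y where "X \<in> C" "Y \<in> C" "a \<in> X" "b \<in> Y" by blast
      moreover have "X \<subseteq> Y \<or> Y \<subseteq> X" using C \<open>X \<in> C\<close> \<open>Y \<in> C\<close> by (auto simp: subset_chain_def)
      moreover have "X \<in> ?I" "Y \<in> ?I" using C \<open>X \<in> C\<close> \<open>Y \<in> C\<close> by (auto simp: subset_chain_def)
      ultimately show "\<not> E a b" using \<open>a \<noteq> b\<close> by blast
    qed
    then show "\<exists>U\<in>?I. \<forall>X\<in>C. X \<subseteq> U" by (intro bexI[of _ "\<Union>C"]) auto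
  qed
  then obtain M where M: "M \<in> ?I" "\<forall>X\<in>?I. M \<subseteq> X \<longrightarrow> X = M" by (rule bexE)
  have "A \<subseteq> M \<union> (\<Union>m\<in>M. {b \<in> A. E m b})"
  proof
    fix a assume a: "a \<in> A"
    show "a \<in> M \<union> (\<Union>m\<in>M. {b \<in> A. E m b})"
    proof (rule ccontr)
      assume n: "a \<notin> M \<union> (\<Union>m\<in>M. {b \<in> A. E m b})"
      then have "\<not> E m a" "\<not> E a m" if "m \<in> M" for m
        using that a n sym[of a m] by auto
      then have "insert a M \<in> ?I" using M(1) a by auto
      then have "insert a M = M" using M(2) by (meson subset_insertI)
      then show False using n by blast
    qed
  qed
  moreover have "countable (M \<union> (\<Union>m\<in>M. {b \<in> A. E m b}))" if "countable M"
  proof (intro countable_Un countable_UN that)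
    show "countable {b \<in> A. E m b}" if "m \<in> M" for m
      by (rule countable_finite, rule deg) (use that M(1) in auto)
  qed
  ultimately have "uncountable M"
    using unc countable_subset by blast
  then show ?thesis using M(1) by (intro exI[of _ M]) simp
qed

text \<open>Each nonempty member of an uncountable locally finite family is shrunk to an open set
  meeting only finitely many members. The intersection graph of the shrunken sets has finite degree,
  and an uncountable independent set in it supplies \<open>omega1\<close> pairwise disjoint
  ones.\<close>

lemma not_pseudo_aleph1_compact_imp_family:
  assumes "\<not> pseudo_aleph1_compact X"
  shows "\<exists>U. disjoint_locally_finite X (Field omega1) U \<and> (\<forall>a\<in>Field omega1. U a \<noteq> {})"
proof -
  obtain \<U> where U: "\<And>U. U \<in> \<U> \<Longrightarrow> openin X U" "locally_finite_in X \<U>" "uncountable \<U>"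
    using assms unfolding pseudo_aleph1_compact_def by blast
  define A where "A = \<U> - {{}}"
  have A: "uncountable A" using U(3) by (simp add: A_def uncountable_minus_countable)
  have "\<exists>V. openin X V \<and> V \<noteq> {} \<and> V \<subseteq> B \<and> finite {C \<in> \<U>. C \<inter> V \<noteq> {}}" if B: "B \<in> A" for B
  proof -
    obtain x where x: "x \<in> B" "openin X B" using B U(1) by (auto simp: A_def)
    then have "x \<in> topspace X" using openin_subset by blast
    then obtain V where V: "openin X V" "x \<in> V" "finite {C \<in> \<U>. C \<inter> V \<noteq> {}}"
      using U(2) unfolding locally_finite_in_def by blast
    have "finite {C \<in> \<U>. C \<inter> (V \<inter> B) \<noteq> {}}"
      by (rule finite_subset[OF _ V(3)]) auto
    then show ?thesis using V x by (intro exI[of _ "V \<inter> B"]) auto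
  qed
  then obtain V where V: "\<And>B. B \<in> A \<Longrightarrow> openin X (V B) \<and> V B \<noteq> {} \<and> V B \<subseteq> B \<and> finite {C \<in> \<U>. C \<inter> V B \<noteq> {}}"
    by metis
  obtain M where M: "M \<subseteq> A" "uncountable M" "\<And>a b. a \<in> M \<Longrightarrow> b \<in> M \<Longrightarrow> a \<noteq> b \<Longrightarrow> V a \<inter> V b = {}"
  proof -
    have "finite {b \<in> A. V a \<inter> V b \<noteq> {}}" if "a \<in> A" for a
    proof -
      have "{b \<in> A. V a \<inter> V b \<noteq> {}} \<subseteq> {C \<in> \<U>. C \<inter> V a \<noteq> {}}"
        using V by (auto simp: A_def)
      then show ?thesis using V[OF that] finite_subset by blast
    qed
    then have "\<exists>M \<subseteq> A. uncountable M \<and> (\<forall>a\<in>M. \<forall>b\<in>M. a \<noteq> b \<longrightarrow> \<not> V a \<inter> V b \<noteq> {})"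
      by (intro finite_degree_imp_uncountable_independent[OF A]) (auto simp: Int_commute)
    then show thesis using that by (metis (no_types, lifting))
  qed
  obtain f where f: "inj_on f (Field omega1)" "f ` Field omega1 \<subseteq> M"
    using omega1_inj_into_uncountable[OF M(2)] by blast
  have fM: "f a \<in> M" "f a \<in> A" "f a \<in> \<U>" if "a \<in> Field omega1" for a
    using f(2) M(1) that by (auto simp: A_def)
  have "disjoint_locally_finite X (Field omega1) (V \<circ> f)"
    unfolding disjoint_locally_finite_def
  proof (intro conjI ballI)
    show "openin X ((V \<circ> f) a)" if "a \<in> Field omega1" for a
      using V fM[OF that] by simp
    show "disjoint_family_on (V \<circ> f) (Field omega1)"
      unfolding disjoint_family_on_def comp_def using M(3) fM f(1) by (metis inj_on_def)
    fix x assume "x \<in> topspace X"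
    then obtain N where N: "openin X N" "x \<in> N" "finite {C \<in> \<U>. C \<inter> N \<noteq> {}}"
      using U(2) unfolding locally_finite_in_def by blast
    have "finite {a \<in> Field omega1. (V \<circ> f) a \<inter> N \<noteq> {}}"
    proof (rule finite_imageD)
      have "f ` {a \<in> Field omega1. (V \<circ> f) a \<inter> N \<noteq> {}} \<subseteq> {C \<in> \<U>. C \<inter> N \<noteq> {}}"
        using fM V by fastforce
      then show "finite (f ` {a \<in> Field omega1. (V \<circ> f) a \<inter> N \<noteq> {}})"
        using N(3) finite_subset by blast
      show "inj_on f {a \<in> Field omega1. (V \<circ> f) a \<inter> N \<noteq> {}}"
        by (rule inj_on_subset[OF f(1)]) auto
    qed
    then show "\<exists>N. openin X N \<and> x \<in> N \<and> finite {a \<in> Field omega1. (V \<circ> f) a \<inter> N \<noteq> {}}"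
      using N by blast
  qed
  moreover have "\<forall>a\<in>Field omega1. (V \<circ> f) a \<noteq> {}" using V fM by simp
  ultimately show ?thesis by blast
qed

text \<open>For a disjoint family the sum has at most one term. The form as a sum lets it be
  compared locally with a finite sum of continuous functions.\<close>

definition glue :: "'i set \<Rightarrow> ('i \<Rightarrow> 'a set) \<Rightarrow> ('i \<Rightarrow> 'a \<Rightarrow> real) \<Rightarrow> 'a \<Rightarrow> real" where
  "glue W U q x = (\<Sum>a\<in>{a\<in>W. x \<in> U a}. q a x)"

lemma glue_outside: "(\<And>a. a \<in> W \<Longrightarrow> x \<notin> U a) \<Longrightarrow> glue W U q x = 0"
  unfolding glue_def by (metis (mono_tags, lifting) mem_Collect_eq sum.neutral)

lemma glue_inside:
  assumes "disjoint_family_on U W" "a \<in> W" "x \<in> U a"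
  shows "glue W U q x = q a x"
proof -
  have "{a\<in>W. x \<in> U a} = {a}" using assms by (auto simp: disjoint_family_on_def)
  then show ?thesis by (simp add: glue_def)
qed

text \<open>Near a point the sum may be taken over the fixed finite set of indices whose
  \<open>U a\<close> meets a neighbourhood, since the added terms vanish by \<open>zero\<close>. The
  pasting lemma joins these local descriptions.\<close>

lemma continuous_map_glue:
  assumes U: "disjoint_locally_finite X W U"
    and q: "\<And>a. a \<in> W \<Longrightarrow> continuous_map X euclideanreal (q a)"
    and zero: "\<And>a x. a \<in> W \<Longrightarrow> x \<in> topspace X - U a \<Longrightarrow> q a x = 0"
  shows "continuous_map X euclideanreal (glue W U q)"
proof -
  have "\<forall>x\<in>topspace X. \<exists>V. openin X V \<and> x \<in> V \<and> finite {a \<in> W. U a \<inter> V \<noteq> {}}"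
    using U by (simp add: disjoint_locally_finite_def)
  then obtain V where V: "\<And>x. x \<in> topspace X \<Longrightarrow> openin X (V x) \<and> x \<in> V x \<and> finite {a \<in> W. U a \<inter> V x \<noteq> {}}"
    by metis
  let ?f = "\<lambda>x y. \<Sum>a\<in>{a \<in> W. U a \<inter> V x \<noteq> {}}. q a y"
  have eq: "glue W U q y = ?f x y" if "x \<in> topspace X" "y \<in> V x" for x y
    unfolding glue_def
  proof (rule sum.mono_neutral_left)
    show "\<forall>a\<in>{a \<in> W. U a \<inter> V x \<noteq> {}} - {a \<in> W. y \<in> U a}. q a y = 0"
      using zero that V[OF that(1)] openin_subset by blast
  qed (use V that in auto)
  show ?thesis
  proof (rule pasting_lemma[where I = "topspace X" and T = V and f = ?f])
    show "continuous_map (subtopology X (V x)) euclideanreal (?f x)" if "x \<in> topspace X" for x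
      using V[OF that] by (intro continuous_map_from_subtopology continuous_map_sum) (auto intro: q)
    show "\<exists>j. j \<in> topspace X \<and> x \<in> V j \<and> glue W U q x = ?f j x" if "x \<in> topspace X" for x
      using V[OF that] eq[OF that] that by blast
    show "?f i x = ?f j x" if "i \<in> topspace X" "j \<in> topspace X" "x \<in> topspace X \<inter> V i \<inter> V j" for i j x
      using eq[OF that(1), of x] eq[OF that(2), of x] that(3) by simp
  qed (use V in blast)
qed

lemma disjoint_locally_finite_Times:
  assumes "disjoint_locally_finite X W U"
  shows "disjoint_locally_finite (prod_topology X Y) W (\<lambda>a. U a \<times> topspace Y)"
  unfolding disjoint_locally_finite_def
proof (intro conjI ballI)
  show "openin (prod_topology X Y) (U a \<times> topspace Y)" if "a \<in> W" for a
    using assms that by (simp add: disjoint_locally_finite_def openin_prod_Times_iff)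
  show "disjoint_family_on (\<lambda>a. U a \<times> topspace Y) W"
    using assms by (auto simp: disjoint_locally_finite_def disjoint_family_on_def)
  fix z assume "z \<in> topspace (prod_topology X Y)"
  then obtain x y where z: "z = (x, y)" "x \<in> topspace X" "y \<in> topspace Y" by auto
  then obtain V where V: "openin X V" "x \<in> V" "finite {a \<in> W. U a \<inter> V \<noteq> {}}"
    using assms unfolding disjoint_locally_finite_def by blast
  have "finite {a \<in> W. (U a \<times> topspace Y) \<inter> (V \<times> topspace Y) \<noteq> {}}"
    by (rule finite_subset[OF _ V(3)]) auto
  then show "\<exists>V. openin (prod_topology X Y) V \<and> z \<in> V \<and> finite {a \<in> W. U a \<times> topspace Y \<inter> V \<noteq> {}}"
    using V z by (intro exI[of _ "V \<times> topspace Y"]) (auto simp: openin_prod_Times_iff)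
qed

section \<open>Coarser group topologies from factorizations\<close>

text \<open>The Hausdorff axiom is left out on purpose: a homomorphism into a second-countable group
  can have a nontrivial kernel, and the topology it induces on \<open>G\<close> then does not
  separate points.\<close>

definition coarser_group_topology :: "('a, 'm) monoid_scheme \<Rightarrow> 'a topology \<Rightarrow> 'a topology \<Rightarrow> bool" where
  "coarser_group_topology G T J \<longleftrightarrow>
     topspace J = carrier G \<and> (\<forall>U. openin J U \<longrightarrow> openin T U) \<and>
     continuous_map (prod_topology J J) J (\<lambda>(x, y). x \<otimes>\<^bsub>G\<^esub> y) \<and>
     continuous_map J J (\<lambda>x. inv\<^bsub>G\<^esub> x) \<and> completely_regular_space J"

lemma completely_regular_space_pullback:
  assumes "completely_regular_space P" and e: "e ` A \<subseteq> topspace P"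
  shows "completely_regular_space (pullback_topology A e P)"
  unfolding completely_regular_space_alt'
proof (intro allI impI)
  fix S x assume S: "openin (pullback_topology A e P) S" "x \<in> S"
  then obtain V where V: "openin P V" "S = e -` V \<inter> A"
    by (auto simp: openin_pullback_topology)
  then have "e x \<in> V" using S by blast
  then obtain f where f: "continuous_map P euclideanreal f" "f (e x) = 0" "f ` (topspace P - V) \<subseteq> {1}"
    using assms(1) V(1) unfolding completely_regular_space_alt' by meson
  have "(f \<circ> e) ` (topspace (pullback_topology A e P) - S) \<subseteq> {1}"
    using f(3) e V(2) by (auto simp: topspace_pullback_topology)
  then show "\<exists>f. continuous_map (pullback_topology A e P) euclideanreal f \<and> f x = 0 \<and>
      f ` (topspace (pullback_topology A e P) - S) \<subseteq> {1}"
    using continuous_map_pullback[OF f(1)] f(2) by (intro exI[of _ "f \<circ> e"]) simp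
qed

lemma second_countable_enum_base:
  assumes "second_countable X"
  shows "\<exists>b :: nat \<Rightarrow> 'a set. (\<forall>n. openin X (b n)) \<and> (\<forall>U x. openin X U \<and> x \<in> U \<longrightarrow> (\<exists>n. x \<in> b n \<and> b n \<subseteq> U))"
proof -
  obtain \<B> where B: "countable \<B>" "\<forall>V\<in>\<B>. openin X V"
    "\<forall>U x. openin X U \<and> x \<in> U \<longrightarrow> (\<exists>V \<in> \<B>. x \<in> V \<and> V \<subseteq> U)"
    using assms unfolding second_countable_def by blast
  let ?b = "from_nat_into (insert {} \<B>)"
  have r: "range ?b = insert {} \<B>"
    by (rule range_from_nat_into) (use B in auto)
  have "openin X (?b n)" for n
  proof -
    have "?b n \<in> insert {} \<B>" using r by blast
    then show ?thesis using B(2) by auto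
  qed
  moreover have "\<exists>n. x \<in> ?b n \<and> ?b n \<subseteq> U" if U: "openin X U" "x \<in> U" for U x
  proof -
    obtain V where V: "V \<in> \<B>" "x \<in> V" "V \<subseteq> U" using U B(3) by blast
    then have "V \<in> range ?b" using r by blast
    then show ?thesis using V by blast
  qed
  ultimately show ?thesis by (intro exI[of _ ?b]) simp
qed

lemma second_countable_iff_base:
  "second_countable X \<longleftrightarrow> (\<exists>\<B>. is_base X \<B> \<and> countable \<B>)"
  unfolding second_countable_def is_base_def by auto

text \<open>Each \<open>f\<close> in \<open>\<F>\<close> factors through a homomorphism
  \<open>h f\<close> into a second-countable group, and \<open>J\<close> is the initial topology of
  all these homomorphisms. A map into \<open>J\<close> is continuous once its compositions with the
  \<open>h f\<close> are, which yields the group operations.\<close>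

lemma r_factorizable_initial_topology:
  fixes G :: "('a, 'm) monoid_scheme"
  assumes G: "topological_group G T" and R: "r_factorizable G T"
    and F: "\<And>f. f \<in> \<F> \<Longrightarrow> continuous_map T euclideanreal f"
  shows "\<exists>J. coarser_group_topology G T J \<and> (\<forall>f\<in>\<F>. continuous_map J euclideanreal f) \<and>
           (\<exists>\<B>. is_base J \<B> \<and> |\<B>| \<le>o |Fpow (\<F> \<times> (UNIV :: nat set))| )"
proof -
  interpret group G using G by (simp add: topological_group_def)
  have topT: "topspace T = carrier G" using G by (simp add: topological_group_def)
  have "\<forall>f\<in>\<F>. \<exists>(H :: real monoid) TH h g. topological_group H TH \<and> second_countable TH \<and>
      h \<in> hom G H \<and> continuous_map T TH h \<and> continuous_map TH euclideanreal g \<and> (\<forall>x\<in>carrier G. f x = g (h x))"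
    using R F unfolding r_factorizable_def factors_through_def by meson
  then obtain H :: "('a \<Rightarrow> real) \<Rightarrow> real monoid" and TH h g where
    fac: "\<And>f. f \<in> \<F> \<Longrightarrow> topological_group (H f) (TH f) \<and> second_countable (TH f) \<and>
      h f \<in> hom G (H f) \<and> continuous_map T (TH f) (h f) \<and> continuous_map (TH f) euclideanreal (g f) \<and>
      (\<forall>x\<in>carrier G. f x = g f (h f x))"
    by metis
  have H: "group (H f)" "topspace (TH f) = carrier (H f)" "completely_regular_space (TH f)"
    "continuous_map (prod_topology (TH f) (TH f)) (TH f) (\<lambda>(x, y). x \<otimes>\<^bsub>H f\<^esub> y)"
    "continuous_map (TH f) (TH f) (\<lambda>x. inv\<^bsub>H f\<^esub> x)" if "f \<in> \<F>" for f
    using fac[OF that] by (auto simp: topological_group_def)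
  have hcar: "h f x \<in> carrier (H f)" if "f \<in> \<F>" "x \<in> carrier G" for f x
    using fac[OF that(1)] that(2) by (auto simp: hom_def Pi_def)
  define P where "P = product_topology TH \<F>"
  define e where "e x = (\<lambda>f\<in>\<F>. h f x)" for x
  define J where "J = pullback_topology (carrier G) e P"
  have eP: "e ` carrier G \<subseteq> topspace P"
    using hcar H by (auto simp: e_def P_def)
  then have topJ: "topspace J = carrier G"
    by (auto simp: J_def topspace_pullback_topology)
  have into_J: "continuous_map Y J k"
    if "\<And>y. y \<in> topspace Y \<Longrightarrow> k y \<in> carrier G" "\<And>f. f \<in> \<F> \<Longrightarrow> continuous_map Y (TH f) (\<lambda>y. h f (k y))"
    for Y :: "'z topology" and k
    unfolding J_def
  proof (rule continuous_map_pullback')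
    show "continuous_map Y P (e \<circ> k)"
      unfolding P_def continuous_map_componentwise using that(2) by (auto simp: e_def)
    show "topspace Y \<subseteq> k -` carrier G" using that(1) by auto
  qed
  have hJ: "continuous_map J (TH f) (h f)" if "f \<in> \<F>" for f
  proof (rule continuous_map_eq)
    show "continuous_map J (TH f) ((\<lambda>z. z f) \<circ> e)"
      unfolding J_def P_def by (intro continuous_map_pullback continuous_map_product_coordinates that)
  qed (simp add: e_def that)
  have coarser: "openin T U" if "openin J U" for U
  proof -
    have "continuous_map T J id"
      by (rule into_J) (use fac topT in auto)
    then have "openin T {x \<in> topspace T. x \<in> U}"
      using that openin_continuous_map_preimage by fastforce
    moreover have "{x \<in> topspace T. x \<in> U} = U" using openin_subset[OF that] topJ topT by auto
    ultimately show ?thesis by simp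
  qed
  have mult: "continuous_map (prod_topology J J) J (\<lambda>(x, y). x \<otimes>\<^bsub>G\<^esub> y)"
  proof (rule into_J)
    fix f assume f: "f \<in> \<F>"
    have "continuous_map (prod_topology J J) (prod_topology (TH f) (TH f)) (\<lambda>(x, y). (h f x, h f y))"
      using hJ[OF f] by (subst continuous_map_prod_top) auto
    from continuous_map_compose[OF this H(4)[OF f]]
    show "continuous_map (prod_topology J J) (TH f) (\<lambda>z. h f (case z of (x, y) \<Rightarrow> x \<otimes>\<^bsub>G\<^esub> y))"
      by (rule continuous_map_eq) (use fac[OF f] in \<open>auto simp: topJ hom_mult\<close>)
  qed (auto simp: topJ)
  have inv: "continuous_map J J (\<lambda>x. inv\<^bsub>G\<^esub> x)"
  proof (rule into_J)
    fix f assume f: "f \<in> \<F>"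
    have "group_hom G (H f) (h f)"
      using fac[OF f] H(1)[OF f] is_group by (simp add: group_hom_def group_hom_axioms_def)
    then interpret h: group_hom G "H f" "h f" .
    from continuous_map_compose[OF hJ[OF f] H(5)[OF f]]
    show "continuous_map J (TH f) (\<lambda>x. h f (inv\<^bsub>G\<^esub> x))"
      by (rule continuous_map_eq) (simp add: topJ)
  qed (simp add: topJ)
  have "completely_regular_space P"
    using H(3) by (simp add: P_def completely_regular_space_product_topology)
  then have creg: "completely_regular_space J"
    unfolding J_def using eP by (rule completely_regular_space_pullback)
  have cont: "continuous_map J euclideanreal f" if "f \<in> \<F>" for f
  proof (rule continuous_map_eq)
    show "continuous_map J euclideanreal (g f \<circ> h f)"
      by (rule continuous_map_compose[OF hJ[OF that]]) (use fac[OF that] in blast)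
  qed (use fac[OF that] in \<open>simp add: topJ\<close>)
  have "\<exists>b :: nat \<Rightarrow> real set. (\<forall>n. openin (TH f) (b n)) \<and>
      (\<forall>U x. openin (TH f) U \<and> x \<in> U \<longrightarrow> (\<exists>n. x \<in> b n \<and> b n \<subseteq> U))" if "f \<in> \<F>" for f
    by (rule second_countable_enum_base) (use fac[OF that] in blast)
  then obtain b :: "('a \<Rightarrow> real) \<Rightarrow> nat \<Rightarrow> real set" where
    b: "\<And>f n. f \<in> \<F> \<Longrightarrow> openin (TH f) (b f n)"
      "\<And>f U x. f \<in> \<F> \<Longrightarrow> openin (TH f) U \<Longrightarrow> x \<in> U \<Longrightarrow> \<exists>n. x \<in> b f n \<and> b f n \<subseteq> U"
    by metis
  \<comment> \<open>A finite set of pairs \<open>(f, n)\<close> encodes an intersection of subbasic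
    sets, \<open>n\<close> being a position in the enumerated base of \<open>TH f\<close>; the empty
    set encodes the whole space.\<close>
  define S where "S A = {x \<in> carrier G. \<forall>(f, n)\<in>A. h f x \<in> b f n}" for A
  have "is_base J (S ` Fpow (\<F> \<times> UNIV))"
    unfolding is_base_def
  proof (intro conjI ballI allI impI)
    fix V assume "V \<in> S ` Fpow (\<F> \<times> UNIV)"
    then obtain A where A: "A \<subseteq> \<F> \<times> UNIV" "finite A" "V = S A" by (auto simp: Fpow_def)
    show "openin J V"
      unfolding \<open>V = S A\<close> using A(2,1)
    proof (induction A)
      case empty
      have "S {} = topspace J" by (simp add: S_def topJ)
      then show ?case by simp
    next
      case (insert p A)
      obtain f n where p: "p = (f, n)" "f \<in> \<F>" using insert by (cases p) auto
      have "S (insert p A) = {x \<in> topspace J. h f x \<in> b f n} \<inter> S A"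
        by (auto simp: S_def topJ p)
      moreover have "openin J {x \<in> topspace J. h f x \<in> b f n}"
        by (rule openin_continuous_map_preimage[OF hJ[OF p(2)] b(1)[OF p(2)]])
      ultimately show ?case using insert by auto
    qed
  next
    fix U x assume "openin J U \<and> x \<in> U"
    then obtain V where V: "openin P V" "U = e -` V \<inter> carrier G" "e x \<in> V" "x \<in> carrier G"
      by (auto simp: J_def openin_pullback_topology)
    then obtain B where B: "finite {f \<in> \<F>. B f \<noteq> topspace (TH f)}" "\<And>f. f \<in> \<F> \<Longrightarrow> openin (TH f) (B f)"
      "e x \<in> Pi\<^sub>E \<F> B" "Pi\<^sub>E \<F> B \<subseteq> V"
      unfolding P_def openin_product_topology_alt by meson
    have "h f x \<in> B f" if "f \<in> \<F>" for f
      using B(3) that by (auto simp: e_def PiE_def Pi_def)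
    then have "\<exists>n. h f x \<in> b f n \<and> b f n \<subseteq> B f" if "f \<in> \<F>" for f
      using b(2)[OF that B(2)[OF that]] that by blast
    then obtain n where n: "\<And>f. f \<in> \<F> \<Longrightarrow> h f x \<in> b f (n f) \<and> b f (n f) \<subseteq> B f"
      by metis
    let ?A = "(\<lambda>f. (f, n f)) ` {f \<in> \<F>. B f \<noteq> topspace (TH f)}"
    have "?A \<in> Fpow (\<F> \<times> UNIV)" using B(1) by (auto simp: Fpow_def)
    moreover have "x \<in> S ?A" using n V(4) by (auto simp: S_def)
    moreover have "S ?A \<subseteq> U"
    proof
      fix y assume y: "y \<in> S ?A"
      have "h f y \<in> B f" if f: "f \<in> \<F>" for f
      proof (cases "B f = topspace (TH f)")
        case True
        then show ?thesis using y hcar[OF f] H(2)[OF f] by (simp add: S_def)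
      next
        case False
        then show ?thesis using y n[OF f] f by (auto simp: S_def)
      qed
      then have "e y \<in> Pi\<^sub>E \<F> B" by (auto simp: e_def)
      then show "y \<in> U" using B(4) V(2) y by (auto simp: S_def)
    qed
    ultimately show "\<exists>V\<in>S ` Fpow (\<F> \<times> UNIV). x \<in> V \<and> V \<subseteq> U" by blast
  qed
  moreover have "|S ` Fpow (\<F> \<times> (UNIV :: nat set))| \<le>o |Fpow (\<F> \<times> (UNIV :: nat set))|"
    by (rule card_of_image)
  ultimately show ?thesis
    unfolding coarser_group_topology_def using topJ coarser mult inv creg cont
    by (intro exI[of _ J] conjI exI[of _ "S ` Fpow (\<F> \<times> UNIV)"]) auto
qed

lemma r_factorizable_second_countable_topology:
  assumes G: "topological_group G T" and R: "r_factorizable G T"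
    and F: "\<And>f. f \<in> \<F> \<Longrightarrow> continuous_map T euclideanreal f" and "countable \<F>"
  shows "\<exists>J. coarser_group_topology G T J \<and> second_countable J \<and> (\<forall>f\<in>\<F>. continuous_map J euclideanreal f)"
proof -
  obtain J \<B> where J: "coarser_group_topology G T J" "\<forall>f\<in>\<F>. continuous_map J euclideanreal f"
    "is_base J \<B>" "|\<B>| \<le>o |Fpow (\<F> \<times> (UNIV :: nat set))|"
    using r_factorizable_initial_topology[OF G R F] by blast
  have "countable (Fpow (\<F> \<times> (UNIV :: nat set)))"
    using \<open>countable \<F>\<close> by (intro countable_Fpow) simp
  then have "countable \<B>"
    using J(4) unfolding countable_card_le_natLeq using ordLeq_transitive by blast
  then have "second_countable J" using J(3) second_countable_iff_base by blast
  then show ?thesis using J by blast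
qed

section \<open>Comparing group topologies at the identity\<close>

lemma coarser_group_topologyD:
  assumes "coarser_group_topology G T J"
  shows "topspace J = carrier G" "openin J U \<Longrightarrow> openin T U"
  using assms by (auto simp: coarser_group_topology_def)

lemma (in monoid) continuous_map_translation:
  assumes top: "topspace J = carrier G"
    and mult: "continuous_map (prod_topology J J) J (\<lambda>(x, y). x \<otimes> y)" and a: "a \<in> carrier G"
  shows "continuous_map J J (\<lambda>x. a \<otimes> x)"
proof -
  have "continuous_map J (prod_topology J J) (\<lambda>x. (a, x))"
    using a top by (simp add: continuous_map_pairwise comp_def)
  from continuous_map_compose[OF this mult] show ?thesis by (simp add: comp_def)
qed

lemma topological_group_imp_coarser:
  "topological_group G T \<Longrightarrow> coarser_group_topology G T T"
  by (simp add: topological_group_def coarser_group_topology_def)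

lemma coarser_group_topology_translation:
  assumes "group G" "coarser_group_topology G T J" "a \<in> carrier G"
  shows "continuous_map J J (\<lambda>x. a \<otimes>\<^bsub>G\<^esub> x)"
proof -
  interpret group G by fact
  show ?thesis
    using assms by (intro continuous_map_translation) (auto simp: coarser_group_topology_def)
qed

text \<open>Homogeneity: for \<open>x\<close> in \<open>U\<close>, the translate of \<open>U\<close>
  by the inverse of \<open>x\<close> contains a \<open>J\<close>-open \<open>P\<close> around the
  identity, and the translate of \<open>P\<close> by \<open>x\<close> is a
  \<open>J\<close>-neighbourhood of \<open>x\<close> inside \<open>U\<close>.\<close>

lemma coarser_group_topology_at_one:
  assumes G: "group G" and J: "coarser_group_topology G T J" and K: "coarser_group_topology G T' K"
    and one: "\<And>V. openin K V \<Longrightarrow> \<one>\<^bsub>G\<^esub> \<in> V \<Longrightarrow> \<exists>P. openin J P \<and> \<one>\<^bsub>G\<^esub> \<in> P \<and> P \<subseteq> V"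
    and U: "openin K U"
  shows "openin J U"
proof (subst openin_subopen, intro ballI)
  interpret group G by fact
  fix x assume x: "x \<in> U"
  have xG: "x \<in> carrier G" using openin_subset[OF U] coarser_group_topologyD(1)[OF K] x by auto
  have "openin K {y \<in> topspace K. x \<otimes>\<^bsub>G\<^esub> y \<in> U}"
    by (rule openin_continuous_map_preimage[OF coarser_group_topology_translation[OF G K xG] U])
  moreover have "\<one>\<^bsub>G\<^esub> \<in> {y \<in> topspace K. x \<otimes>\<^bsub>G\<^esub> y \<in> U}"
    using x xG coarser_group_topologyD(1)[OF K] by simp
  ultimately obtain P where P: "openin J P" "\<one>\<^bsub>G\<^esub> \<in> P" "P \<subseteq> {y \<in> topspace K. x \<otimes>\<^bsub>G\<^esub> y \<in> U}"
    using one by blast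
  let ?Q = "{y \<in> topspace J. inv\<^bsub>G\<^esub> x \<otimes>\<^bsub>G\<^esub> y \<in> P}"
  have "openin J ?Q"
    by (rule openin_continuous_map_preimage[OF coarser_group_topology_translation[OF G J] P(1)]) (simp add: xG)
  moreover have "x \<in> ?Q" using P(2) xG coarser_group_topologyD(1)[OF J] by simp
  moreover have "?Q \<subseteq> U"
  proof
    fix y assume "y \<in> ?Q"
    then have "y \<in> carrier G" "x \<otimes>\<^bsub>G\<^esub> (inv\<^bsub>G\<^esub> x \<otimes>\<^bsub>G\<^esub> y) \<in> U"
      using P(3) coarser_group_topologyD(1)[OF J] by auto
    then show "y \<in> U" using xG by (simp flip: m_assoc)
  qed
  ultimately show "\<exists>T. openin J T \<and> x \<in> T \<and> T \<subseteq> U" by blast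
qed

lemma continuous_map_finer_domain:
  assumes "continuous_map X Z f" "topspace Y = topspace X" "\<And>U. openin X U \<Longrightarrow> openin Y U"
  shows "continuous_map Y Z f"
  using assms by (auto simp: continuous_map_def)

section \<open>Functions attached to a base, submetrizability and separation\<close>

lemma is_baseD:
  assumes "is_base X \<B>"
  shows "V \<in> \<B> \<Longrightarrow> openin X V" "openin X U \<Longrightarrow> x \<in> U \<Longrightarrow> \<exists>V\<in>\<B>. x \<in> V \<and> V \<subseteq> U"
  using assms unfolding is_base_def by blast+

text \<open>One function is chosen for each pair \<open>(V', V)\<close> of basic sets that admits a
  function above 1/2 on \<open>V'\<close> and zero off \<open>V\<close>. Indexing by pairs of basic
  sets gives the cardinality bound.\<close>

lemma completely_regular_base_functions:
  assumes X: "completely_regular_space X" and B: "is_base X \<B>"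
  obtains \<F> where "|\<F>| \<le>o |\<B> \<times> \<B>|" "\<forall>f\<in>\<F>. continuous_map X euclideanreal f"
    "\<forall>U x. openin X U \<and> x \<in> U \<longrightarrow> (\<exists>f\<in>\<F>. f x > 1/2 \<and> (\<forall>y\<in>topspace X - U. f y = 0))"
proof -
  define good where "good f p \<longleftrightarrow> continuous_map X euclideanreal f \<and> (\<forall>x\<in>fst p. f x > 1/2) \<and>
    (\<forall>y\<in>topspace X - snd p. f y = 0)" for f :: "'a \<Rightarrow> real" and p
  define P where "P = {p \<in> \<B> \<times> \<B>. \<exists>f. good f p}"
  define q where "q p = (SOME f. good f p)" for p
  have q: "good (q p) p" if "p \<in> P" for p
    unfolding q_def using that by (intro someI_ex[of "\<lambda>f. good f p"]) (simp add: P_def)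
  have "|q ` P| \<le>o |\<B> \<times> \<B>|"
    by (rule ordLeq_transitive[OF card_of_image card_of_mono1]) (auto simp: P_def)
  moreover have "\<forall>f\<in>q ` P. continuous_map X euclideanreal f"
    using q by (auto simp: good_def)
  moreover have "\<exists>f\<in>q ` P. f x > 1/2 \<and> (\<forall>y\<in>topspace X - U. f y = 0)" if U: "openin X U" "x \<in> U" for U x
  proof -
    obtain V where V: "V \<in> \<B>" "x \<in> V" "V \<subseteq> U" using is_baseD(2)[OF B U] by blast
    then have "openin X V" using is_baseD(1)[OF B] by blast
    then obtain f where f: "continuous_map X euclideanreal f" "f x = 1" "\<forall>y \<in> topspace X - V. f y = 0"
      using completely_regular_bump[OF X _ V(2)] by blast
    have "x \<in> topspace X" using U openin_subset by blast
    then have "x \<in> {y \<in> topspace X. f y > 1/2}" using f(2) by simp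
    then obtain V' where V': "V' \<in> \<B>" "x \<in> V'" "V' \<subseteq> {y \<in> topspace X. f y > 1/2}"
      using is_baseD(2)[OF B openin_superlevel[OF f(1)]] by blast
    \<comment> \<open>The bump \<open>f\<close> only shows that the pair is admissible. The function
      chosen for the pair may differ from \<open>f\<close>, but it too exceeds 1/2 at
      \<open>x\<close> and vanishes off \<open>V\<close>.\<close>
    have "good f (V', V)" unfolding good_def using f V'(3) by auto
    then have p: "(V', V) \<in> P" using V(1) V'(1) by (auto simp: P_def)
    have "q (V', V) x > 1/2" "\<forall>y\<in>topspace X - U. q (V', V) y = 0"
      using q[OF p] V'(2) V(3) unfolding good_def by auto
    then show ?thesis using p by (intro bexI[of _ "q (V', V)"] conjI) auto
  qed
  ultimately show thesis by (intro that[of "q ` P"] allI impI) (assumption, assumption, elim conjE)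
qed

text \<open>The countably many functions attached to a base separate points, so \<open>e\<close>
  injects the space into a countable power of the real line. \<open>Y\<close> is the topology pulled
  back along \<open>e\<close>, hence homeomorphic to a subspace of that metrizable power.\<close>

lemma second_countable_imp_submetrizable:
  assumes X: "completely_regular_space X" "Hausdorff_space X" "second_countable X"
  shows "submetrizable X"
proof -
  obtain \<B> where B: "is_base X \<B>" "countable \<B>"
    using X(3) unfolding second_countable_iff_base by (elim exE conjE)
  obtain \<F> where F: "|\<F>| \<le>o |\<B> \<times> \<B>|" "\<forall>f\<in>\<F>. continuous_map X euclideanreal f"
    "\<forall>U x. openin X U \<and> x \<in> U \<longrightarrow> (\<exists>f\<in>\<F>. f x > 1/2 \<and> (\<forall>y\<in>topspace X - U. f y = 0))"
    by (rule completely_regular_base_functions[OF X(1) B(1)])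
  have "countable (\<B> \<times> \<B>)" using B(2) by simp
  then have cF: "countable \<F>"
    using F(1) unfolding countable_card_le_natLeq using ordLeq_transitive by blast
  define P where "P = product_topology (\<lambda>_. euclideanreal) \<F>"
  define e where "e x = (\<lambda>f\<in>\<F>. f x)" for x :: 'a
  define Y where "Y = pullback_topology (topspace X) e P"
  have inj: "inj_on e (topspace X)"
  proof (rule inj_onI, rule ccontr)
    fix x y assume xy: "x \<in> topspace X" "y \<in> topspace X" "e x = e y" "x \<noteq> y"
    then obtain U where U: "openin X U" "x \<in> U" "y \<notin> U"
      using X(2) unfolding Hausdorff_space_def disjnt_def by blast
    then obtain f where f: "f \<in> \<F>" "f x > 1/2" "f y = 0" using F(3) xy(2) by blast
    then show False using fun_cong[OF xy(3), of f] by (simp add: e_def)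
  qed
  have topY: "topspace Y = topspace X"
    by (auto simp: Y_def topspace_pullback_topology P_def e_def)
  have "continuous_map X P e"
    unfolding P_def continuous_map_componentwise using F(2) by (auto simp: e_def)
  then have coarser: "openin X U" if "openin Y U" for U
    using that openin_continuous_map_preimage[of X P e]
    by (auto simp: Y_def openin_pullback_topology vimage_def Int_def conj_commute)
  have cY: "continuous_map Y P e"
    using continuous_map_pullback[OF continuous_map_id] unfolding Y_def by (metis id_o)
  define e' where "e' = inv_into (topspace X) e"
  have e': "e' (e x) = x" if "x \<in> topspace X" for x
    using inj that by (simp add: e'_def)
  have "homeomorphic_maps Y (subtopology P (e ` topspace X)) e e'"
    unfolding homeomorphic_maps_def
  proof (intro conjI ballI)
    show "continuous_map Y (subtopology P (e ` topspace X)) e"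
      using cY topY by (auto simp: continuous_map_in_subtopology)
    show "continuous_map (subtopology P (e ` topspace X)) Y e'"
      unfolding Y_def
    proof (rule continuous_map_pullback')
      show "continuous_map (subtopology P (e ` topspace X)) P (e \<circ> e')"
        by (rule continuous_map_eq[OF continuous_map_from_subtopology[OF continuous_map_id]])
          (auto simp: e')
    qed (auto simp: e')
  qed (auto simp: e' topY)
  then have "Y homeomorphic_space subtopology P (e ` topspace X)"
    by (auto simp: homeomorphic_space_def)
  moreover have "metrizable_space (subtopology P (e ` topspace X))"
  proof (rule metrizable_space_subtopology)
    have "countable {i \<in> \<F>. \<not> (\<exists>a. topspace euclideanreal \<subseteq> {a})}"
      by (rule countable_subset[OF _ cF]) auto
    then show "metrizable_space P"
      unfolding P_def metrizable_space_product_topology by (simp add: metrizable_space_euclidean)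
  qed
  ultimately have "metrizable_space Y" using homeomorphic_metrizable_space by blast
  then show ?thesis unfolding submetrizable_def using topY coarser by blast
qed

text \<open>Functions that separate the identity from the other elements separate all pairs after
  translation by \<open>inv x\<close>, and this restores the Hausdorff axiom.\<close>

lemma coarser_group_topology_imp_topological_group:
  assumes G: "group G" and J: "coarser_group_topology G T J"
    and sep: "\<And>z. z \<in> carrier G \<Longrightarrow> z \<noteq> \<one>\<^bsub>G\<^esub> \<Longrightarrow> \<exists>f. continuous_map J euclideanreal f \<and> f z \<noteq> f \<one>\<^bsub>G\<^esub>"
  shows "topological_group G J"
proof -
  interpret group G by fact
  have top: "topspace J = carrier G" using coarser_group_topologyD(1)[OF J] .
  have "Hausdorff_space J"
    unfolding Hausdorff_space_def
  proof (intro allI impI)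
    fix x y assume xy: "x \<in> topspace J \<and> y \<in> topspace J \<and> x \<noteq> y"
    then have z: "inv\<^bsub>G\<^esub> x \<otimes>\<^bsub>G\<^esub> y \<in> carrier G" "inv\<^bsub>G\<^esub> x \<otimes>\<^bsub>G\<^esub> y \<noteq> \<one>\<^bsub>G\<^esub>"
      by (auto simp: top) (metis inv_closed inv_equality inv_inv)
    then obtain f where f: "continuous_map J euclideanreal f" "f (inv\<^bsub>G\<^esub> x \<otimes>\<^bsub>G\<^esub> y) \<noteq> f \<one>\<^bsub>G\<^esub>"
      using sep by blast
    let ?g = "f \<circ> (\<lambda>w. inv\<^bsub>G\<^esub> x \<otimes>\<^bsub>G\<^esub> w)"
    have g: "continuous_map J euclideanreal ?g"
      using xy by (intro continuous_map_compose[OF coarser_group_topology_translation[OF G J] f(1)]) (simp add: top)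
    have "?g x \<noteq> ?g y" using f(2) xy by (auto simp: top)
    then obtain A B where AB: "open A" "open B" "?g x \<in> A" "?g y \<in> B" "A \<inter> B = {}"
      by (rule separation_t2[THEN iffD1, elim_format]) blast
    have "openin J {w \<in> topspace J. ?g w \<in> A}" "openin J {w \<in> topspace J. ?g w \<in> B}"
      using AB openin_continuous_map_preimage[OF g, of A] openin_continuous_map_preimage[OF g, of B]
      by simp_all
    then show "\<exists>U V. openin J U \<and> openin J V \<and> x \<in> U \<and> y \<in> V \<and> disjnt U V"
      using AB xy by (intro exI conjI) (assumption, assumption, auto simp: disjnt_def)
  qed
  then show ?thesis using J G by (simp add: topological_group_def coarser_group_topology_def)
qed

section \<open>Groups that are not pseudo-\<open>\<aleph>\<^sub>1\<close>-compact\<close>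

text \<open>The witnesses \<open>U\<close> and \<open>p\<close> against pseudo-\<aleph>1-compactness
  are parameters, so that the results can be applied to a second topology on the same group in
  \<open>coarser_not_r_factorizable\<close>.\<close>

locale r_factorizable_family = group G for G :: "('a, 'm) monoid_scheme" (structure) +
  fixes T :: "'a topology" and U :: "nat set \<Rightarrow> 'a set" and p :: "nat set \<Rightarrow> 'a"
  assumes tg: "topological_group G T" and rf: "r_factorizable G T"
    and family: "disjoint_locally_finite T (Field omega1) U"
    and p: "a \<in> Field omega1 \<Longrightarrow> p a \<in> U a"
begin

section \<open>Countable families of neighbourhoods of the identity\<close>

lemma topspace_eq [simp]: "topspace T = carrier G"
  using tg by (simp add: topological_group_def)

lemma creg: "completely_regular_space T"
  using tg by (simp add: topological_group_def)

lemma U_open: "a \<in> Field omega1 \<Longrightarrow> openin T (U a)"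
  by (rule disjoint_locally_finiteD(1)[OF family])

lemma U_nbhd: "a \<in> Field omega1 \<Longrightarrow> openin T (U a) \<and> p a \<in> U a"
  using U_open p by simp

lemma U_disjoint: "disjoint_family_on U (Field omega1)"
  by (rule disjoint_locally_finiteD(2)[OF family])

lemma p_closed [simp]: "a \<in> Field omega1 \<Longrightarrow> p a \<in> carrier G"
  using p U_open openin_subset by fastforce

lemma translation: "a \<in> carrier G \<Longrightarrow> continuous_map T T (\<lambda>x. a \<otimes> x)"
  by (rule coarser_group_topology_translation[OF is_group topological_group_imp_coarser[OF tg]])

lemma not_second_countable: "\<not> second_countable T"
proof
  assume "second_countable T"
  then have "countable (Field omega1)"
  proof (rule second_countable_separated_imp_countable[where y = p and V = U])
    show "openin T (U a) \<and> p a \<in> U a" if "a \<in> Field omega1" for a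
      using U_open[OF that] p[OF that] by blast
    show "p a \<notin> U b \<or> p b \<notin> U a" if "a \<in> Field omega1" "b \<in> Field omega1" "a \<noteq> b" for a b
      using disjoint_family_onD[OF U_disjoint that] p[OF that(1)] by blast
  qed
  then show False using uncountable_Field_omega1 by blast
qed

lemma bump_family:
  assumes "\<And>a. a \<in> Field omega1 \<Longrightarrow> openin T (V a) \<and> p a \<in> V a"
  obtains f where "\<forall>a\<in>Field omega1. continuous_map T euclideanreal (f a) \<and> f a (p a) = 1 \<and>
    (\<forall>y\<in>carrier G - V a. f a y = 0)"
proof -
  have "\<exists>f. continuous_map T euclideanreal f \<and> f (p a) = 1 \<and> (\<forall>y\<in>carrier G - V a. f y = 0)"
    if "a \<in> Field omega1" for a
    using completely_regular_bump[OF creg, of "V a" "p a"] assms[OF that] by simp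
  then show thesis using that by metis
qed

lemma bump_nbhd:
  assumes J: "coarser_group_topology G T J" and f: "continuous_map J euclideanreal f" "f \<one> = 1" "\<forall>y\<in>carrier G - V. f y = 0"
  shows "\<exists>P. openin J P \<and> \<one> \<in> P \<and> P \<subseteq> V"
proof (intro exI conjI)
  show "openin J {y \<in> topspace J. f y > 1/2}" by (rule openin_superlevel[OF f(1)])
  show "\<one> \<in> {y \<in> topspace J. f y > 1/2}" using f coarser_group_topologyD(1)[OF J] by simp
  show "{y \<in> topspace J. f y > 1/2} \<subseteq> V"
  proof
    fix y assume y: "y \<in> {y \<in> topspace J. f y > 1/2}"
    then have "y \<in> carrier G" "f y \<noteq> 0" using coarser_group_topologyD(1)[OF J] by auto
    then show "y \<in> V" using f(3) by blast
  qed
qed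

text \<open>Bump functions at the identity, one for each \<open>V\<close>, become continuous for one
  second-countable group topology; their superlevel sets are the neighbourhoods
  \<open>P\<close>.\<close>

lemma countable_nbhds_imp_topology:
  assumes "countable \<V>" and V: "\<And>V. V \<in> \<V> \<Longrightarrow> openin T V \<and> \<one> \<in> V"
  shows "\<exists>J. coarser_group_topology G T J \<and> second_countable J \<and>
    (\<forall>V\<in>\<V>. \<exists>P. openin J P \<and> \<one> \<in> P \<and> P \<subseteq> V)"
proof -
  have "\<exists>f. continuous_map T euclideanreal f \<and> f \<one> = 1 \<and> (\<forall>y \<in> carrier G - V. f y = 0)"
    if "V \<in> \<V>" for V
    using completely_regular_bump[OF creg] V[OF that] by simp
  then obtain f where f: "\<And>V. V \<in> \<V> \<Longrightarrow> continuous_map T euclideanreal (f V) \<and> f V \<one> = 1 \<and>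
      (\<forall>y \<in> carrier G - V. f V y = 0)"
    by metis
  obtain J where J: "coarser_group_topology G T J" "second_countable J"
    "\<forall>g\<in>f ` \<V>. continuous_map J euclideanreal g"
    using r_factorizable_second_countable_topology[OF tg rf, of "f ` \<V>"] f \<open>countable \<V>\<close> by auto
  have "\<exists>P. openin J P \<and> \<one> \<in> P \<and> P \<subseteq> V" if "V \<in> \<V>" for V
    by (rule bump_nbhd[OF J(1), of "f V"]) (use f[OF that] J(3) that in auto)
  then show ?thesis using J by (intro exI[of _ J]) simp
qed

text \<open>A second-countable group topology with neighbourhoods of the identity inside all members
  of a countable base at the identity would equal \<open>T\<close>, while the disjoint sets
  \<open>U a\<close> keep \<open>T\<close> from being second-countable.\<close>

lemma no_countable_nbhd_base:
  assumes "countable \<V>" and V: "\<And>V. V \<in> \<V> \<Longrightarrow> openin T V \<and> \<one> \<in> V"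
    and base: "\<And>N. openin T N \<Longrightarrow> \<one> \<in> N \<Longrightarrow> \<exists>V\<in>\<V>. V \<subseteq> N"
  shows False
proof -
  obtain J where J: "coarser_group_topology G T J" "second_countable J"
    "\<And>V. V \<in> \<V> \<Longrightarrow> \<exists>P. openin J P \<and> \<one> \<in> P \<and> P \<subseteq> V"
    using countable_nbhds_imp_topology[OF assms(1) V] by blast
  have "openin J N" if "openin T N" for N
  proof (rule coarser_group_topology_at_one[OF is_group J(1) topological_group_imp_coarser[OF tg] _ that])
    fix V assume "openin T V" "\<one> \<in> V"
    then obtain V' where "V' \<in> \<V>" "V' \<subseteq> V" using base by blast
    then show "\<exists>P. openin J P \<and> \<one> \<in> P \<and> P \<subseteq> V"
      using J(3) by (meson subset_trans)
  qed
  then have "J = T"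
    using coarser_group_topologyD(2)[OF J(1)] by (auto simp: topology_eq)
  then show False using J(2) not_second_countable by simp
qed

text \<open>Otherwise points \<open>y b\<close> and functions \<open>q b\<close> are chosen
  recursively such that \<open>q b\<close> is 1 at the identity and 0 at \<open>y b\<close>, and
  \<open>q a\<close> is 1 at \<open>y b\<close> for every earlier \<open>a\<close>. Through the
  glued function \<open>?F\<close>, each \<open>?O a\<close> is open in one second-countable
  topology; it contains \<open>y a\<close> and no later \<open>y b\<close>, which is impossible for
  \<open>omega1\<close> points.\<close>

lemma one_is_G_delta:
  "\<exists>\<V>. countable \<V> \<and> (\<forall>V\<in>\<V>. openin T V \<and> \<one> \<in> V) \<and> topspace T \<inter> \<Inter>\<V> = {\<one>}"
proof (rule ccontr)
  assume contr: "\<not> ?thesis"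
  \<comment> \<open>Countably many functions with value 1 at the identity are all 1 on a countable
    intersection of neighbourhoods, which contains another point because the identity is not a
    G_delta.\<close>
  have common: "\<exists>y\<in>carrier G. y \<noteq> \<one> \<and> (\<forall>g\<in>\<G>. g y = 1)"
    if "countable \<G>" and G: "\<And>g. g \<in> \<G> \<Longrightarrow> continuous_map T euclideanreal g \<and> g \<one> = 1" for \<G>
  proof -
    let ?N = "\<lambda>(g, n). {z \<in> topspace T. dist (g z) 1 < inverse (real (Suc n))}"
    have "countable (?N ` (\<G> \<times> UNIV))" using \<open>countable \<G>\<close> by simp
    moreover have "\<forall>V\<in>?N ` (\<G> \<times> UNIV). openin T V \<and> \<one> \<in> V"
    proof safe
      fix g n assume g: "g \<in> \<G>"
      have "openin T {z \<in> topspace T. g z \<in> ball 1 (inverse (real (Suc n)))}"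
        using G[OF g] by (intro openin_continuous_map_preimage[of T euclideanreal]) auto
      then show "openin T {z \<in> topspace T. dist (g z) 1 < inverse (real (Suc n))}"
        by (simp add: dist_commute)
    next
      fix g n assume "g \<in> \<G>"
      then have "g \<one> = 1" using G by blast
      then show "\<one> \<in> topspace T" "dist (g \<one>) 1 < inverse (real (Suc n))" by auto
    qed
    ultimately have "topspace T \<inter> \<Inter>(?N ` (\<G> \<times> UNIV)) \<noteq> {\<one>}"
      using contr by blast
    moreover have "\<one> \<in> topspace T \<inter> \<Inter>(?N ` (\<G> \<times> UNIV))"
      using \<open>\<forall>V\<in>?N ` (\<G> \<times> UNIV). openin T V \<and> \<one> \<in> V\<close> by auto
    ultimately obtain y where y: "y \<in> topspace T \<inter> \<Inter>(?N ` (\<G> \<times> UNIV))" "y \<noteq> \<one>" by blast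
    have "g y = 1" if "g \<in> \<G>" for g
    proof (rule ccontr)
      assume "g y \<noteq> 1"
      then obtain n where "inverse (real (Suc n)) < dist (g y) 1"
        using reals_Archimedean[of "dist (g y) 1"] by auto
      moreover have "dist (g y) 1 < inverse (real (Suc n))" using y(1) that by auto
      ultimately show False by simp
    qed
    then show ?thesis using y by auto
  qed
  obtain \<phi> where "\<forall>a\<in>Field omega1. continuous_map T euclideanreal (\<phi> a) \<and> \<phi> a (p a) = 1 \<and>
      (\<forall>y\<in>carrier G - U a. \<phi> a y = 0)"
    by (rule bump_family[OF U_nbhd])
  then have \<phi>: "continuous_map T euclideanreal (\<phi> a) \<and> \<phi> a (p a) = 1 \<and> (\<forall>y\<in>carrier G - U a. \<phi> a y = 0)"
    if "a \<in> Field omega1" for a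
    using that by blast
  \<comment> \<open>The pair \<open>r\<close> stands for \<open>y b\<close> and \<open>q b\<close>.
    The conditions on the bump functions put \<open>p a \<otimes> y b\<close> into
    \<open>U a\<close> for all \<open>a\<close> up to \<open>b\<close>, where \<open>?F\<close> can
    be read off. The recursion runs over the whole type, so the condition is void outside the field
    of \<open>omega1\<close>.\<close>
  define P where "P f b r \<longleftrightarrow> (b \<in> Field omega1 \<longrightarrow>
      fst r \<in> carrier G \<and> fst r \<noteq> \<one> \<and> \<phi> b (p b \<otimes> fst r) = 1 \<and>
      (\<forall>a\<in>underS omega1 b. \<phi> a (p a \<otimes> fst r) = 1 \<and> snd (f a) (fst r) = 1) \<and>
      continuous_map T euclideanreal (snd r) \<and> snd r \<one> = 1 \<and> snd r (fst r) = 0)"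
    for f :: "nat set \<Rightarrow> 'a \<times> ('a \<Rightarrow> real)" and b r
  have "\<exists>f. \<forall>b. P f b (f b)"
  proof (rule dependent_wf_choice[OF wf_omega1])
    fix f g :: "nat set \<Rightarrow> 'a \<times> ('a \<Rightarrow> real)" and b r
    assume "\<And>z. (z, b) \<in> omega1 - Id \<Longrightarrow> f z = g z"
    then have "\<forall>a\<in>underS omega1 b. f a = g a" by (auto simp: underS_def)
    then show "P f b r = P g b r" by (simp add: P_def)
  next
    fix b and f :: "nat set \<Rightarrow> 'a \<times> ('a \<Rightarrow> real)"
    assume IH: "\<And>a. (a, b) \<in> omega1 - Id \<Longrightarrow> P f a (f a)"
    show "\<exists>r. P f b r"
    proof (cases "b \<in> Field omega1")
      case b: True
      let ?h = "\<lambda>a z. \<phi> a (p a \<otimes> z)"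
      let ?G = "?h ` insert b (underS omega1 b) \<union> (\<lambda>a. snd (f a)) ` underS omega1 b"
      have h: "continuous_map T euclideanreal (?h a) \<and> ?h a \<one> = 1" if "a \<in> Field omega1" for a
        using continuous_map_compose[OF translation[OF p_closed[OF that]], of euclideanreal "\<phi> a"] \<phi>[OF that] that
        by (simp add: comp_def)
      have f: "continuous_map T euclideanreal (snd (f a)) \<and> snd (f a) \<one> = 1" if "a \<in> underS omega1 b" for a
        using IH[of a] that underS_omega1_subset by (auto simp: P_def underS_def Field_def)
      have "countable ?G" using countable_underS_omega1 by simp
      moreover have "continuous_map T euclideanreal g \<and> g \<one> = 1" if "g \<in> ?G" for g
        using that h f b underS_omega1_subset by blast
      ultimately obtain y where y: "y \<in> carrier G" "y \<noteq> \<one>" "\<And>g. g \<in> ?G \<Longrightarrow> g y = 1"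
        using common[of ?G] by meson
      have "openin T (topspace T - {y})"
        using closedin_Hausdorff_singleton[of T y] tg y(1) by (intro openin_diff openin_topspace) (auto simp: topological_group_def)
      then obtain q where q: "continuous_map T euclideanreal q" "q \<one> = 1" "\<forall>z\<in>topspace T - (topspace T - {y}). q z = 0"
        using completely_regular_bump[OF creg, of "topspace T - {y}" \<one>] y by auto
      have "P f b (y, q)"
        unfolding P_def using y q by auto
      then show ?thesis by blast
    qed (simp add: P_def)
  qed
  then obtain f where f: "\<And>b. P f b (f b)" by blast
  define y where "y b = fst (f b)" for b
  define q where "q b = snd (f b)" for b
  have yq: "y b \<in> carrier G" "\<phi> b (p b \<otimes> y b) = 1" "continuous_map T euclideanreal (q b)" "q b (y b) = 0"
    if "b \<in> Field omega1" for b
    using f[of b] that by (auto simp: P_def y_def q_def)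
  have later: "\<phi> a (p a \<otimes> y b) = 1" "q a (y b) = 1" if "b \<in> Field omega1" "a \<in> underS omega1 b" for a b
    using f[of b] that by (auto simp: P_def y_def q_def)
  have inU: "x \<in> U a" if "a \<in> Field omega1" "x \<in> carrier G" "\<phi> a x = 1" for a x
    using \<phi>[OF that(1)] that(2,3) by (metis DiffI zero_neq_one)
  \<comment> \<open>Translation moves \<open>q a\<close> to \<open>p a\<close>, and the factor
    \<open>\<phi> a\<close> makes the product vanish off \<open>U a\<close>.\<close>
  let ?F = "glue (Field omega1) U (\<lambda>a x. \<phi> a x * q a (inv (p a) \<otimes> x))"
  have F: "?F (p a \<otimes> z) = q a z" if "a \<in> Field omega1" "z \<in> carrier G" "\<phi> a (p a \<otimes> z) = 1" for a z
  proof -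
    have "?F (p a \<otimes> z) = \<phi> a (p a \<otimes> z) * q a (inv (p a) \<otimes> (p a \<otimes> z))"
      using that by (intro glue_inside[OF U_disjoint]) (auto intro!: inU)
    then show ?thesis using that by (simp flip: m_assoc)
  qed
  have "continuous_map T euclideanreal ?F"
  proof (rule continuous_map_glue[OF family])
    fix a assume a: "a \<in> Field omega1"
    have "continuous_map T euclideanreal (q a \<circ> (\<lambda>x. inv (p a) \<otimes> x))"
      using a by (intro continuous_map_compose[OF translation yq(3)]) auto
    then show "continuous_map T euclideanreal (\<lambda>x. \<phi> a x * q a (inv (p a) \<otimes> x))"
      using \<phi>[OF a] by (intro continuous_map_real_mult) (auto simp: comp_def)
  qed (use \<phi> in auto)
  then obtain J where J: "coarser_group_topology G T J" "second_countable J" "continuous_map J euclideanreal ?F"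
    using r_factorizable_second_countable_topology[OF tg rf, of "{?F}"] by auto
  have top: "topspace J = carrier G" by (rule coarser_group_topologyD(1)[OF J(1)])
  let ?O = "\<lambda>a. {z \<in> topspace J. ?F (p a \<otimes> z) < 1/2}"
  from J(2) have "countable (Field omega1)"
  proof (rule second_countable_separated_imp_countable[where y = y and V = ?O])
    show "openin J (?O a) \<and> y a \<in> ?O a" if a: "a \<in> Field omega1" for a
    proof
      have "continuous_map J euclideanreal (?F \<circ> (\<lambda>z. p a \<otimes> z))"
        by (rule continuous_map_compose[OF coarser_group_topology_translation[OF is_group J(1)] J(3)]) (simp add: a)
      then show "openin J (?O a)"
        using openin_sublevel[of J "\<lambda>z. ?F (p a \<otimes> z)" "1/2"] by (simp add: comp_def)
      show "y a \<in> ?O a" using F[OF a yq(1,2)[OF a]] yq[OF a] by (simp add: top)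
    qed
    have *: "y b \<notin> ?O a" if "b \<in> Field omega1" "a \<in> underS omega1 b" for a b
    proof -
      have "a \<in> Field omega1" using that(2) underS_omega1_subset by blast
      then show ?thesis using F[of a "y b"] later[OF that] yq(1)[OF that(1)] by simp
    qed
    show "y a \<notin> ?O b \<or> y b \<notin> ?O a" if "a \<in> Field omega1" "b \<in> Field omega1" "a \<noteq> b" for a b
      using underS_omega1_total[OF that] *[of a b] *[of b a] that by blast
  qed
  then show False using uncountable_Field_omega1 by blast
qed

end

section \<open>Pseudocharacter, weight and coarser group topologies\<close>

context r_factorizable_family
begin

lemma eq_if_inv_mult_eq_one: "x \<in> carrier G \<Longrightarrow> y \<in> carrier G \<Longrightarrow> inv x \<otimes> y = \<one> \<Longrightarrow> y = x"
  by (metis inv_closed inv_equality inv_inv)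

lemma openin_translate:
  assumes J: "coarser_group_topology G T J" and "x \<in> carrier G" "openin J V"
  shows "openin J {z \<in> carrier G. x \<otimes> z \<in> V}"
  using openin_continuous_map_preimage[OF coarser_group_topology_translation[OF is_group J assms(2)] assms(3)]
    coarser_group_topologyD(1)[OF J] by simp

lemmas openin_translate_T = openin_translate[OF topological_group_imp_coarser[OF tg]]

text \<open>Translation carries the countable family at the identity to every other point.\<close>

lemma pseudocharacter_countable: "pseudocharacter T \<le>o natLeq"
proof -
  obtain \<V> where V: "countable \<V>" "\<forall>V\<in>\<V>. openin T V \<and> \<one> \<in> V" "topspace T \<inter> \<Inter>\<V> = {\<one>}"
    using one_is_G_delta by (elim exE conjE)
  have "t1_space T" using tg by (simp add: topological_group_def Hausdorff_imp_t1_space)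
  moreover have "points_are_intersections T natLeq"
    unfolding points_are_intersections_def
  proof
    fix x assume "x \<in> topspace T"
    then have x: "x \<in> carrier G" by simp
    let ?N = "(\<lambda>V. {z \<in> carrier G. inv x \<otimes> z \<in> V}) ` \<V>"
    have "|?N| \<le>o natLeq"
      using V(1) by (simp flip: countable_card_le_natLeq)
    moreover have "\<forall>U\<in>?N. openin T U \<and> x \<in> U"
      using V(2) x openin_translate_T by auto
    moreover have "topspace T \<inter> \<Inter>?N = {x}"
    proof (intro equalityI subsetI)
      fix z assume z: "z \<in> topspace T \<inter> \<Inter>?N"
      then have "inv x \<otimes> z \<in> topspace T \<inter> \<Inter>\<V>" using x by auto
      then have "inv x \<otimes> z = \<one>" using V(3) by blast
      then show "z \<in> {x}" using eq_if_inv_mult_eq_one[OF x] z by auto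
    next
      fix z assume "z \<in> {x}"
      then show "z \<in> topspace T \<inter> \<Inter>?N" using \<open>\<forall>U\<in>?N. openin T U \<and> x \<in> U\<close> x by auto
    qed
    ultimately show "\<exists>\<N>. |\<N>| \<le>o natLeq \<and> (\<forall>U\<in>\<N>. openin T U \<and> x \<in> U) \<and> topspace T \<inter> \<Inter>\<N> = {x}"
      by (intro exI[of _ ?N] conjI)
  qed
  ultimately show ?thesis
    using pseudocharacter_le_iff[OF _ natLeq_Card_order] by blast
qed

text \<open>There is one bump function for each of the countably many neighbourhoods that intersect
  to the identity; any other element lies outside one of them and gets value 0 instead of 1.\<close>

lemma separating_functions:
  obtains \<F> where "countable \<F>" "\<forall>f\<in>\<F>. continuous_map T euclideanreal f"
    "\<forall>z\<in>carrier G. z \<noteq> \<one> \<longrightarrow> (\<exists>f\<in>\<F>. f z \<noteq> f \<one>)"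
proof -
  obtain \<V> where V: "countable \<V>" "\<forall>V\<in>\<V>. openin T V \<and> \<one> \<in> V" "topspace T \<inter> \<Inter>\<V> = {\<one>}"
    using one_is_G_delta by (elim exE conjE)
  have "\<exists>f. continuous_map T euclideanreal f \<and> f \<one> = 1 \<and> (\<forall>y \<in> carrier G - V. f y = 0)" if "V \<in> \<V>" for V
    using completely_regular_bump[OF creg, of V \<one>] V(2) that by simp
  then obtain f where f: "\<And>V. V \<in> \<V> \<Longrightarrow> continuous_map T euclideanreal (f V) \<and> f V \<one> = 1 \<and>
      (\<forall>y \<in> carrier G - V. f V y = 0)"
    by metis
  show thesis
  proof (rule that[of "f ` \<V>"])
    show "\<forall>z\<in>carrier G. z \<noteq> \<one> \<longrightarrow> (\<exists>f\<in>f ` \<V>. f z \<noteq> f \<one>)"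
    proof (intro ballI impI)
      fix z assume z: "z \<in> carrier G" "z \<noteq> \<one>"
      then have "z \<notin> topspace T \<inter> \<Inter>\<V>" using V(3) by simp
      then obtain V where "V \<in> \<V>" "z \<notin> V" using z by auto
      then show "\<exists>f\<in>f ` \<V>. f z \<noteq> f \<one>"
        using f[of V] z by (intro bexI[of _ "f V"]) auto
    qed
  qed (use V f in auto)
qed

lemma submetrizable_T: "submetrizable T"
proof -
  obtain \<F> where F: "countable \<F>" "\<forall>f\<in>\<F>. continuous_map T euclideanreal f"
    "\<forall>z\<in>carrier G. z \<noteq> \<one> \<longrightarrow> (\<exists>f\<in>\<F>. f z \<noteq> f \<one>)"
    by (rule separating_functions)
  obtain J where J: "coarser_group_topology G T J" "second_countable J" "\<forall>f\<in>\<F>. continuous_map J euclideanreal f"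
    using r_factorizable_second_countable_topology[OF tg rf, of \<F>] F(1,2) by blast
  have "topological_group G J"
    by (rule coarser_group_topology_imp_topological_group[OF is_group J(1)]) (use F(3) J(3) in blast)
  then have "submetrizable J"
    using J(2) by (intro second_countable_imp_submetrizable) (auto simp: topological_group_def)
  then show ?thesis
    using coarser_group_topologyD[OF J(1)] unfolding submetrizable_def by (metis topspace_eq)
qed

text \<open>\<open>f\<close> is already continuous for a second-countable group topology
  \<open>K\<close>. Each member of a countable \<open>K\<close>-base at the identity is replaced by
  a smaller member of \<open>\<B>\<close>; a group topology with neighbourhoods of the identity
  inside all of these refines \<open>K\<close>.\<close>

lemma continuous_by_small_nbhds:
  assumes B: "is_base T \<B>" and f: "continuous_map T euclideanreal f"
  obtains \<V> where "countable \<V>" "\<V> \<subseteq> {V \<in> \<B>. \<one> \<in> V}"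
    "\<forall>J. coarser_group_topology G T J \<longrightarrow> (\<forall>V\<in>\<V>. \<exists>P. openin J P \<and> \<one> \<in> P \<and> P \<subseteq> V) \<longrightarrow>
      continuous_map J euclideanreal f"
proof -
  obtain K where K: "coarser_group_topology G T K" "second_countable K" "continuous_map K euclideanreal f"
    using r_factorizable_second_countable_topology[OF tg rf, of "{f}"] f by auto
  obtain \<C> where C: "is_base K \<C>" "countable \<C>"
    using K(2) unfolding second_countable_iff_base by (elim exE conjE)
  let ?C = "{C \<in> \<C>. \<one> \<in> C}"
  have "\<exists>V\<in>\<B>. \<one> \<in> V \<and> V \<subseteq> C" if "C \<in> ?C" for C
  proof (rule is_baseD(2)[OF B])
    show "openin T C"
      using that is_baseD(1)[OF C(1)] coarser_group_topologyD(2)[OF K(1)] by blast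
  qed (use that in simp)
  then obtain v where v: "\<And>C. C \<in> ?C \<Longrightarrow> v C \<in> \<B> \<and> \<one> \<in> v C \<and> v C \<subseteq> C" by metis
  show thesis
  proof (rule that[of "v ` ?C"])
    show "countable (v ` ?C)" using C(2) by simp
    show "v ` ?C \<subseteq> {V \<in> \<B>. \<one> \<in> V}" using v by auto
    show "\<forall>J. coarser_group_topology G T J \<longrightarrow> (\<forall>V\<in>v ` ?C. \<exists>P. openin J P \<and> \<one> \<in> P \<and> P \<subseteq> V) \<longrightarrow>
      continuous_map J euclideanreal f"
    proof (intro allI impI, rule continuous_map_finer_domain[OF K(3)])
      fix J assume J: "coarser_group_topology G T J" "\<forall>V\<in>v ` ?C. \<exists>P. openin J P \<and> \<one> \<in> P \<and> P \<subseteq> V"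
      show "topspace J = topspace K"
        using coarser_group_topologyD(1)[OF J(1)] coarser_group_topologyD(1)[OF K(1)] by simp
      fix N assume N: "openin K N"
      show "openin J N"
      proof (rule coarser_group_topology_at_one[OF is_group J(1) K(1) _ N])
        fix V assume "openin K V" "\<one> \<in> V"
        then obtain C where C': "C \<in> \<C>" "\<one> \<in> C" "C \<subseteq> V" using is_baseD(2)[OF C(1)] by blast
        then obtain P where "openin J P" "\<one> \<in> P" "P \<subseteq> v C" using J(2) by blast
        then show "\<exists>P. openin J P \<and> \<one> \<in> P \<and> P \<subseteq> V"
          using v[of C] C' by (intro exI[of _ P]) auto
      qed
    qed
  qed
qed

text \<open>The basic neighbourhoods of the identity are enumerated as \<open>e a\<close>, and
  \<open>J a\<close> is a second-countable group topology that takes care of those before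
  \<open>a\<close>. The glued bumps are so narrow that the one at \<open>p a\<close> prevents
  \<open>J a\<close>-continuity, for every \<open>a\<close>. Yet continuity of the glued function is
  governed by countably many sets \<open>e a\<close>, whose indices all precede some index.\<close>

lemma no_small_base:
  assumes B: "is_base T \<B>" and card: "|\<B>| \<le>o omega1"
  shows False
proof -
  let ?B = "{V \<in> \<B>. \<one> \<in> V}"
  have "|?B| \<le>o omega1"
    by (rule ordLeq_transitive[OF card_of_mono1 card]) auto
  moreover have "?B \<noteq> {}"
    using is_baseD(2)[OF B openin_topspace] by auto
  ultimately obtain e where e: "e ` Field omega1 = ?B"
    using omega1_enumerates[of ?B] by blast
  have eB: "openin T (e a) \<and> \<one> \<in> e a" if "a \<in> Field omega1" for a
  proof -
    have "e a \<in> ?B" using e that by blast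
    then show ?thesis using is_baseD(1)[OF B] by blast
  qed
  have "\<exists>J. coarser_group_topology G T J \<and> second_countable J \<and> (\<forall>V\<in>e ` underS omega1 a.
      \<exists>P. openin J P \<and> \<one> \<in> P \<and> P \<subseteq> V)" for a
  proof (rule countable_nbhds_imp_topology)
    show "countable (e ` underS omega1 a)" using countable_underS_omega1 by simp
    show "openin T V \<and> \<one> \<in> V" if "V \<in> e ` underS omega1 a" for V
      using that eB underS_omega1_subset by blast
  qed
  then obtain J where J: "\<And>a. coarser_group_topology G T (J a)" "\<And>a. second_countable (J a)"
    "\<And>a V. V \<in> e ` underS omega1 a \<Longrightarrow>
      \<exists>P. openin (J a) P \<and> \<one> \<in> P \<and> P \<subseteq> V"
    by metis
  \<comment> \<open>Otherwise the sets \<open>?v C\<close>, for the members \<open>C\<close> around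
    \<open>p a\<close> of a countable base of \<open>J a\<close>, would form a countable base of
    \<open>T\<close> at the identity.\<close>
  have "\<exists>V. openin T V \<and> \<one> \<in> V \<and> (\<forall>N. openin (J a) N \<and> p a \<in> N \<longrightarrow> (\<exists>x\<in>N \<inter> U a. inv (p a) \<otimes> x \<notin> V))"
    if a: "a \<in> Field omega1" for a
  proof (rule ccontr)
    assume contr: "\<not> ?thesis"
    obtain \<C> where C: "is_base (J a) \<C>" "countable \<C>"
      using J(2)[of a] unfolding second_countable_iff_base by (elim exE conjE)
    let ?v = "\<lambda>C. {z \<in> carrier G. p a \<otimes> z \<in> C \<inter> U a}"
    show False
    proof (rule no_countable_nbhd_base)
      show "countable (?v ` {C \<in> \<C>. p a \<in> C})" using C(2) by simp
      show "openin T V \<and> \<one> \<in> V" if V: "V \<in> ?v ` {C \<in> \<C>. p a \<in> C}" for V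
      proof -
        obtain C' where C': "C' \<in> \<C>" "p a \<in> C'" "V = ?v C'" using V by blast
        have op: "openin T (C' \<inter> U a)"
          using is_baseD(1)[OF C(1) C'(1)] coarser_group_topologyD(2)[OF J(1)] U_open[OF a] by blast
        then show ?thesis
          using openin_translate_T[OF p_closed[OF a] op] C'(2,3) p[OF a] a by simp
      qed
      fix N assume "openin T N" "\<one> \<in> N"
      then have "\<not> (\<forall>M. openin (J a) M \<and> p a \<in> M \<longrightarrow> (\<exists>x\<in>M \<inter> U a. inv (p a) \<otimes> x \<notin> N))"
        using contr[unfolded not_ex, THEN spec[of _ N]] by simp
      then obtain M where M: "openin (J a) M" "p a \<in> M" "\<And>x. x \<in> M \<inter> U a \<Longrightarrow> inv (p a) \<otimes> x \<in> N"
        by blast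
      obtain C' where C': "C' \<in> \<C>" "p a \<in> C'" "C' \<subseteq> M" using is_baseD(2)[OF C(1) M(1,2)] by blast
      have "?v C' \<subseteq> N"
      proof
        fix z assume z: "z \<in> ?v C'"
        then have "inv (p a) \<otimes> (p a \<otimes> z) \<in> N" using M(3)[of "p a \<otimes> z"] C'(3) by blast
        then show "z \<in> N" using z a by (simp flip: m_assoc)
      qed
      then show "\<exists>V\<in>?v ` {C \<in> \<C>. p a \<in> C}. V \<subseteq> N" using C' by blast
    qed
  qed
  then obtain V where V: "\<And>a. a \<in> Field omega1 \<Longrightarrow> openin T (V a) \<and> \<one> \<in> V a \<and>
      (\<forall>N. openin (J a) N \<and> p a \<in> N \<longrightarrow> (\<exists>x\<in>N \<inter> U a. inv (p a) \<otimes> x \<notin> V a))"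
    by metis
  let ?W = "\<lambda>a. U a \<inter> {z \<in> carrier G. inv (p a) \<otimes> z \<in> V a}"
  have W: "openin T (?W a) \<and> p a \<in> ?W a" if a: "a \<in> Field omega1" for a
    using V[OF a] U_open[OF a] p[OF a] openin_translate_T[of "inv (p a)" "V a"] a by auto
  obtain \<psi> where \<psi>: "\<forall>a\<in>Field omega1. continuous_map T euclideanreal (\<psi> a) \<and> \<psi> a (p a) = 1 \<and>
      (\<forall>y\<in>carrier G - ?W a. \<psi> a y = 0)"
    by (rule bump_family[OF W])
  let ?F = "glue (Field omega1) U \<psi>"
  have "continuous_map T euclideanreal ?F"
    by (rule continuous_map_glue[OF family]) (use \<psi> in auto)
  obtain \<V> where \<V>: "countable \<V>" "\<V> \<subseteq> ?B"
    "\<forall>J. coarser_group_topology G T J \<longrightarrow> (\<forall>V\<in>\<V>. \<exists>P. openin J P \<and> \<one> \<in> P \<and> P \<subseteq> V) \<longrightarrow>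
      continuous_map J euclideanreal ?F"
    by (rule continuous_by_small_nbhds[OF B \<open>continuous_map T euclideanreal ?F\<close>])
  have "\<V> \<subseteq> e ` Field omega1" unfolding e by (rule \<V>(2))
  then have "\<exists>a. a \<in> Field omega1 \<and> e a = V" if "V \<in> \<V>" for V using that by auto
  then obtain i where i: "\<And>V. V \<in> \<V> \<Longrightarrow> i V \<in> Field omega1 \<and> e (i V) = V" by metis
  then obtain a where a: "a \<in> Field omega1" "i ` \<V> \<subseteq> underS omega1 a"
    using countable_bounded_omega1[of "i ` \<V>"] \<V>(1) by auto
  have F: "continuous_map (J a) euclideanreal ?F"
  proof (rule \<V>(3)[rule_format, OF J(1)])
    fix V assume "V \<in> \<V>"
    then have "V \<in> e ` underS omega1 a" using i a(2) by (metis image_eqI image_subset_iff)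
    then show "\<exists>P. openin (J a) P \<and> \<one> \<in> P \<and> P \<subseteq> V" by (rule J(3))
  qed
  let ?N = "{x \<in> topspace (J a). ?F x > 1/2}"
  have "openin (J a) ?N" by (rule openin_superlevel[OF F])
  moreover have "p a \<in> ?N"
    using glue_inside[OF U_disjoint a(1) p[OF a(1)], of \<psi>] \<psi> a(1) coarser_group_topologyD(1)[OF J(1)] by simp
  ultimately obtain x where x: "x \<in> ?N" "x \<in> U a" "inv (p a) \<otimes> x \<notin> V a"
    using V[OF a(1)] by blast
  have "?F x = 0"
    using glue_inside[OF U_disjoint a(1) x(2), of \<psi>] \<psi> a(1) x coarser_group_topologyD(1)[OF J(1)] by simp
  then show False using x(1) by simp
qed

text \<open>\<open>F A\<close> glues the bumps with index in \<open>A\<close>, so its values at the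
  points \<open>p a\<close> determine \<open>A\<close>. A sequence \<open>s\<close> in
  \<open>\<B>\<close> fixes a group topology \<open>J s\<close> with an enumerated base; for
  suitable \<open>s\<close> the function \<open>F A\<close> is \<open>J s\<close>-continuous, and
  \<open>A\<close> is recovered from \<open>s\<close> and a set of positions in that base. Both fit
  into one sequence in \<open>\<B>\<close>.\<close>

lemma ctwo_cexp_omega1_le:
  assumes B: "is_base T \<B>"
  shows "ctwo ^c omega1 \<le>o |\<B>| ^c natLeq"
proof -
  obtain \<phi> where \<phi>: "\<forall>a\<in>Field omega1. continuous_map T euclideanreal (\<phi> a) \<and> \<phi> a (p a) = 1 \<and>
      (\<forall>y\<in>carrier G - U a. \<phi> a y = 0)"
    by (rule bump_family[OF U_nbhd])
  define F where "F A = glue (Field omega1) U (\<lambda>a x. if A a then \<phi> a x else 0)" for A :: "nat set \<Rightarrow> bool"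
  have contF: "continuous_map T euclideanreal (F A)" for A
    unfolding F_def
  proof (rule continuous_map_glue[OF family])
    show "continuous_map T euclideanreal (\<lambda>x. if A a then \<phi> a x else 0)" if "a \<in> Field omega1" for a
      using \<phi> that by (cases "A a") auto
  qed (use \<phi> in auto)
  have Fp: "F A (p a) = (if A a then 1 else 0)" if "a \<in> Field omega1" for A a
    unfolding F_def using glue_inside[OF U_disjoint that p[OF that]] \<phi> that by simp
  define coded where "coded s J b \<longleftrightarrow> coarser_group_topology G T J \<and> (\<forall>n. openin J (b n)) \<and>
      (\<forall>N x. openin J N \<and> x \<in> N \<longrightarrow> (\<exists>n. x \<in> b n \<and> b n \<subseteq> N)) \<and>
      (\<forall>n. \<exists>P. openin J P \<and> \<one> \<in> P \<and> P \<subseteq> s n)" for s b :: "nat \<Rightarrow> 'a set" and J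
  have "\<exists>J b. coded s J b"
    if s: "\<forall>n. openin T (s n) \<and> \<one> \<in> s n" for s :: "nat \<Rightarrow> 'a set"
  proof -
    have "\<exists>J. coarser_group_topology G T J \<and> second_countable J \<and>
        (\<forall>V\<in>range s. \<exists>P. openin J P \<and> \<one> \<in> P \<and> P \<subseteq> V)"
      by (rule countable_nbhds_imp_topology) (use s in auto)
    then obtain J where J: "coarser_group_topology G T J" "second_countable J"
      "\<forall>V\<in>range s. \<exists>P. openin J P \<and> \<one> \<in> P \<and> P \<subseteq> V"
      by (elim exE conjE)
    obtain b :: "nat \<Rightarrow> 'a set" where b: "\<forall>n. openin J (b n)"
      "\<forall>N x. openin J N \<and> x \<in> N \<longrightarrow> (\<exists>n. x \<in> b n \<and> b n \<subseteq> N)"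
      using second_countable_enum_base[OF J(2)] by (elim exE conjE)
    show ?thesis
      unfolding coded_def using J(1,3) b by (intro exI[of _ J] exI[of _ b] conjI) simp_all
  qed
  \<comment> \<open>The topology and its base are functions of \<open>s\<close> alone, chosen before
    any \<open>A\<close> is given, so equal sequences decode alike.\<close>
  then obtain J b where Jb: "\<And>s. \<forall>n. openin T (s n) \<and> \<one> \<in> s n \<Longrightarrow> coded s (J s) (b s)"
    by metis
  have code: "\<exists>s M. range s \<subseteq> \<B> \<and> (\<forall>a\<in>Field omega1. A a \<longleftrightarrow> (\<exists>n\<in>M. p a \<in> b s n))" for A
  proof -
    obtain \<V> where \<V>: "countable \<V>" "\<V> \<subseteq> {V \<in> \<B>. \<one> \<in> V}"
      "\<forall>J. coarser_group_topology G T J \<longrightarrow> (\<forall>V\<in>\<V>. \<exists>P. openin J P \<and> \<one> \<in> P \<and> P \<subseteq> V) \<longrightarrow>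
        continuous_map J euclideanreal (F A)"
      by (rule continuous_by_small_nbhds[OF B contF])
    \<comment> \<open>\<open>V0\<close> makes the enumerated set nonempty, so that
      \<open>from_nat_into\<close> stays inside it even if \<open>\<V>\<close> is empty.\<close>
    obtain V0 where V0: "V0 \<in> \<B>" "\<one> \<in> V0" using is_baseD(2)[OF B openin_topspace, of \<one>] by auto
    let ?s = "from_nat_into (insert V0 \<V>)"
    have r: "range ?s = insert V0 \<V>" by (rule range_from_nat_into) (use \<V>(1) in auto)
    have s: "?s n \<in> \<B> \<and> \<one> \<in> ?s n" for n
    proof -
      have "?s n \<in> insert V0 \<V>" using r by blast
      then show ?thesis using \<V>(2) V0 by auto
    qed
    have sT: "\<forall>n. openin T (?s n) \<and> \<one> \<in> ?s n" using s is_baseD(1)[OF B] by simp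
    have cont: "continuous_map (J ?s) euclideanreal (F A)"
    proof (rule \<V>(3)[rule_format])
      show "coarser_group_topology G T (J ?s)" using Jb[OF sT, unfolded coded_def] by blast
      fix V assume "V \<in> \<V>"
      then obtain n where "V = ?s n" using r by (metis imageE insertCI)
      then show "\<exists>P. openin (J ?s) P \<and> \<one> \<in> P \<and> P \<subseteq> V" using Jb[OF sT, unfolded coded_def] by simp
    qed
    let ?N = "{x \<in> topspace (J ?s). F A x > 1/2}"
    have N: "openin (J ?s) ?N" by (rule openin_superlevel[OF cont])
    have "A a \<longleftrightarrow> (\<exists>n\<in>{n. b ?s n \<subseteq> ?N}. p a \<in> b ?s n)" if a: "a \<in> Field omega1" for a
    proof
      assume "A a"
      then have "p a \<in> ?N" using Fp[OF a, of A] a coarser_group_topologyD(1)[of G T "J ?s"] Jb[OF sT, unfolded coded_def] by simp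
      then obtain n where "p a \<in> b ?s n" "b ?s n \<subseteq> ?N"
        using N Jb[OF sT, unfolded coded_def, THEN conjunct2, THEN conjunct2, THEN conjunct1] by meson
      then show "\<exists>n\<in>{n. b ?s n \<subseteq> ?N}. p a \<in> b ?s n" by (intro bexI[of _ n]) simp_all
    next
      assume "\<exists>n\<in>{n. b ?s n \<subseteq> ?N}. p a \<in> b ?s n"
      then have "F A (p a) > 1/2" by blast
      then show "A a" using Fp[OF a, of A] by (simp split: if_splits)
    qed
    then show ?thesis using s by (intro exI[of _ ?s] exI[of _ "{n. b ?s n \<subseteq> ?N}"]) auto
  qed
  then obtain s M where sM: "\<And>A. range (s A) \<subseteq> \<B>"
    "\<And>A a. a \<in> Field omega1 \<Longrightarrow> A a \<longleftrightarrow> (\<exists>n\<in>M A. p a \<in> b (s A) n)"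
    by metis
  \<comment> \<open>Two distinct basic sets act as binary digits when a set of positions is written
    as a sequence in \<open>\<B>\<close>.\<close>
  obtain B0 B1 where B01: "B0 \<in> \<B>" "B1 \<in> \<B>" "B0 \<noteq> B1"
  proof -
    obtain a where a: "a \<in> Field omega1" using uncountable_Field_omega1 by fastforce
    have "infinite (Field omega1 - {a})" using infinite_Field_omega1 by simp
    then obtain a' where a': "a' \<in> Field omega1" "a' \<noteq> a" by (metis DiffE ex_in_conv finite.emptyI singletonI)
    obtain B0 where B0: "B0 \<in> \<B>" "p a \<in> B0" "B0 \<subseteq> U a" using is_baseD(2)[OF B U_open[OF a] p[OF a]] by blast
    obtain B1 where B1: "B1 \<in> \<B>" "p a' \<in> B1" "B1 \<subseteq> U a'" using is_baseD(2)[OF B U_open[OF a'(1)] p[OF a'(1)]] by blast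
    have "U a \<inter> U a' = {}" using disjoint_family_onD[OF U_disjoint a a'(1)] a'(2) by blast
    then have "B0 \<noteq> B1" using B0 B1 by blast
    then show thesis using that B0(1) B1(1) by blast
  qed
  \<comment> \<open>the even entries of \<open>c A\<close> are \<open>s A\<close>, the odd ones encode the characteristic function of \<open>M A\<close>\<close>
  define c where "c A n = (if even n then s A (n div 2) else if n div 2 \<in> M A then B1 else B0)"
    for A and n :: nat
  have "|Func (Field omega1) (UNIV :: bool set)| \<le>o |Func (UNIV :: nat set) \<B>|"
  proof (rule card_of_ordLeqI)
    show "inj_on c (Func (Field omega1) UNIV)"
    proof (rule inj_onI)
      fix A A' assume AA: "A \<in> Func (Field omega1) UNIV" "A' \<in> Func (Field omega1) UNIV" "c A = c A'"
      have "s A n = s A' n" for n using fun_cong[OF AA(3), of "2 * n"] by (simp add: c_def)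
      then have s: "s A = s A'" by blast
      have "n \<in> M A \<longleftrightarrow> n \<in> M A'" for n
        using fun_cong[OF AA(3), of "2 * n + 1"] B01(3) by (auto simp: c_def split: if_splits)
      then have "M A = M A'" by blast
      then have "A a = A' a" if "a \<in> Field omega1" for a using sM(2)[OF that, of A] sM(2)[OF that, of A'] s by simp
      then show "A = A'" using AA(1,2) by (auto simp: Func_def fun_eq_iff)
    qed
    show "c A \<in> Func UNIV \<B>" if "A \<in> Func (Field omega1) UNIV" for A
      using sM(1)[of A] B01 by (auto simp: Func_def c_def)
  qed
  then show ?thesis by (simp add: cexp_def ctwo_def Field_card_of Field_natLeq)
qed

text \<open>\<open>J\<close> makes the bumps \<open>\<phi> a\<close>, their glued sum
  \<open>?\<Phi>\<close> and countably many separating functions continuous; these are at most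
  \<open>omega1\<close> functions, so \<open>J\<close> has a base of size at most
  \<open>omega1\<close>. The sets where \<open>\<phi> a\<close> exceeds 1/2 stay disjoint and
  locally finite in \<open>J\<close>, and \<open>no_small_base\<close> excludes
  factorizability.\<close>

lemma coarser_not_r_factorizable:
  obtains J where "coarser_group_topology G T J" "topological_group G J" "\<not> r_factorizable G J"
proof -
  obtain \<S> where S: "countable \<S>" "\<forall>f\<in>\<S>. continuous_map T euclideanreal f"
    "\<forall>z\<in>carrier G. z \<noteq> \<one> \<longrightarrow> (\<exists>f\<in>\<S>. f z \<noteq> f \<one>)"
    by (rule separating_functions)
  obtain \<phi> where \<phi>: "\<forall>a\<in>Field omega1. continuous_map T euclideanreal (\<phi> a) \<and> \<phi> a (p a) = 1 \<and>
      (\<forall>y\<in>carrier G - U a. \<phi> a y = 0)"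
    by (rule bump_family[OF U_nbhd])
  let ?\<Phi> = "glue (Field omega1) U \<phi>"
  let ?F = "insert ?\<Phi> (\<phi> ` Field omega1 \<union> \<S>)"
  have "continuous_map T euclideanreal ?\<Phi>"
    by (rule continuous_map_glue[OF family]) (use \<phi> in auto)
  then have contF: "continuous_map T euclideanreal f" if "f \<in> ?F" for f
    using that \<phi> S(2) by blast
  have "|\<phi> ` Field omega1| \<le>o omega1"
    by (rule ordLeq_ordIso_trans[OF card_of_image card_of_Field_omega1])
  moreover have "|insert ?\<Phi> \<S>| \<le>o omega1"
    using S(1) by (intro countable_imp_le_omega1) simp
  ultimately have "|\<phi> ` Field omega1 \<union> insert ?\<Phi> \<S>| \<le>o omega1"
    using card_of_Un_ordLeq_infinite_Field[OF infinite_Field_omega1 _ _ Card_order_omega1] by blast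
  then have cardF: "|?F| \<le>o omega1" by simp
  obtain J \<B> where J: "coarser_group_topology G T J" "\<forall>f\<in>?F. continuous_map J euclideanreal f"
    "is_base J \<B>" "|\<B>| \<le>o |Fpow (?F \<times> (UNIV :: nat set))|"
    using r_factorizable_initial_topology[OF tg rf contF, of ?F] by blast
  have smallB: "|\<B>| \<le>o omega1"
    using J(4) card_of_Fpow_times_nat_le_omega1[OF cardF] by (rule ordLeq_transitive)
  have top: "topspace J = carrier G" by (rule coarser_group_topologyD(1)[OF J(1)])
  have tgJ: "topological_group G J"
    by (rule coarser_group_topology_imp_topological_group[OF is_group J(1)]) (use S(3) J(2) in blast)
  let ?U = "\<lambda>a. {x \<in> topspace J. \<phi> a x > 1/2}"
  have \<phi>J: "continuous_map J euclideanreal (\<phi> a)" if "a \<in> Field omega1" for a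
    using J(2) that by blast
  have \<Phi>J: "continuous_map J euclideanreal ?\<Phi>" using J(2) by blast
  have pos: "x \<in> U a" if "a \<in> Field omega1" "x \<in> carrier G" "\<phi> a x > 0" for a x
  proof (rule ccontr)
    assume "x \<notin> U a"
    then have "\<phi> a x = 0" using \<phi> that by blast
    then show False using that(3) by simp
  qed
  have UU: "?U a \<subseteq> U a" if "a \<in> Field omega1" for a
  proof
    fix x assume "x \<in> ?U a"
    then show "x \<in> U a" using pos[OF that, of x] top by auto
  qed
  have "\<not> r_factorizable G J"
  proof
    assume rfJ: "r_factorizable G J"
    have "disjoint_locally_finite J (Field omega1) ?U"
      unfolding disjoint_locally_finite_def
    proof (intro conjI ballI)
      show "openin J (?U a)" if "a \<in> Field omega1" for a
        by (rule openin_superlevel[OF \<phi>J[OF that]])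
      show "disjoint_family_on ?U (Field omega1)"
        unfolding disjoint_family_on_def
      proof (intro ballI impI)
        fix a a' assume "a \<in> Field omega1" "a' \<in> Field omega1" "a \<noteq> a'"
        then show "?U a \<inter> ?U a' = {}"
          using UU[of a] UU[of a'] disjoint_family_onD[OF U_disjoint, of a a'] by blast
      qed
      fix x assume x: "x \<in> topspace J"
      \<comment> \<open>If some \<open>\<phi> a\<close> is positive at \<open>x\<close>, the set
        where it is positive lies in \<open>U a\<close> and meets no other member. Otherwise
        \<open>?\<Phi>\<close> is at most 0 at \<open>x\<close>, and its sublevel set at 1/2 misses
        all members.\<close>
      show "\<exists>V. openin J V \<and> x \<in> V \<and> finite {a \<in> Field omega1. ?U a \<inter> V \<noteq> {}}"
      proof (cases "\<exists>a\<in>Field omega1. x \<in> U a \<and> \<phi> a x > 0")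
        case True
        then obtain a where a: "a \<in> Field omega1" "\<phi> a x > 0" by blast
        let ?V = "{x \<in> topspace J. \<phi> a x > 0}"
        have "?V \<subseteq> U a" using pos[OF a(1)] top by auto
        then have "?U a' \<inter> ?V = {}" if "a' \<in> Field omega1" "a' \<noteq> a" for a'
          using UU[OF that(1)] disjoint_family_onD[OF U_disjoint a(1) that(1)] that(2) by blast
        then have "{a' \<in> Field omega1. ?U a' \<inter> ?V \<noteq> {}} \<subseteq> {a}" by blast
        then have "finite {a' \<in> Field omega1. ?U a' \<inter> ?V \<noteq> {}}" by (rule finite_subset) simp
        then show ?thesis
          using openin_superlevel[OF \<phi>J[OF a(1)], of 0] a(2) x by (intro exI[of _ ?V]) simp
      next
        case False
        \<comment> \<open>Bump functions may take negative values, hence an inequality.\<close>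
        have "?\<Phi> x \<le> 0"
        proof (cases "\<exists>a\<in>Field omega1. x \<in> U a")
          case True
          then obtain a where a: "a \<in> Field omega1" "x \<in> U a" by blast
          then show ?thesis using glue_inside[OF U_disjoint a, of \<phi>] False by force
        next
          case False
          then have "?\<Phi> x = 0" by (intro glue_outside) blast
          then show ?thesis by simp
        qed
        let ?V = "{x \<in> topspace J. ?\<Phi> x < 1/2}"
        have "?U a \<inter> ?V = {}" if "a \<in> Field omega1" for a
        proof -
          have "?\<Phi> y = \<phi> a y" if "y \<in> ?U a" for y
            using UU[OF \<open>a \<in> Field omega1\<close>] that by (intro glue_inside[OF U_disjoint \<open>a \<in> Field omega1\<close>]) blast
          then show ?thesis by force
        qed
        then have "{a \<in> Field omega1. ?U a \<inter> ?V \<noteq> {}} = {}" by blast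
        then have "finite {a \<in> Field omega1. ?U a \<inter> ?V \<noteq> {}}" by (simp only: finite.emptyI)
        moreover have "x \<in> ?V" using x \<open>?\<Phi> x \<le> 0\<close> by simp
        ultimately show ?thesis
          using openin_sublevel[OF \<Phi>J, of "1/2"] by (intro exI[of _ ?V] conjI)
      qed
    qed
    then interpret J: r_factorizable_family G J ?U p
      using tgJ rfJ \<phi> top by unfold_locales auto
    show False by (rule J.no_small_base[OF J(3) smallB])
  qed
  then show thesis using that J(1) tgJ by blast
qed

end

section \<open>Products\<close>

text \<open>The topology \<open>Z\<close> stands for a map into a second-countable space through
  which all functions of \<open>\<F>\<close> factor. This is the trace that factorizability of a
  product with a weird group leaves on the other factor.\<close>

definition omega1_functions_factor :: "'a topology \<Rightarrow> bool" where
  "omega1_functions_factor X \<longleftrightarrow>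
     (\<forall>\<F>. |\<F>| \<le>o omega1 \<and> (\<forall>f\<in>\<F>. continuous_map X euclideanreal f) \<longrightarrow>
        (\<exists>Z. topspace Z = topspace X \<and> (\<forall>V. openin Z V \<longrightarrow> openin X V) \<and> second_countable Z \<and>
             (\<forall>f\<in>\<F>. continuous_map Z euclideanreal f)))"

section \<open>Factoring \<open>omega1\<close> functions on one factor of a product\<close>

lemma second_countable_pullback:
  assumes "second_countable P"
  shows "second_countable (pullback_topology A e P)"
proof -
  obtain b :: "nat \<Rightarrow> 'a set" where b: "\<forall>n. openin P (b n)"
    "\<forall>U x. openin P U \<and> x \<in> U \<longrightarrow> (\<exists>n. x \<in> b n \<and> b n \<subseteq> U)"
    using second_countable_enum_base[OF assms] by (elim exE conjE)
  have "is_base (pullback_topology A e P) (range (\<lambda>n. e -` b n \<inter> A))"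
    unfolding is_base_def
  proof (intro conjI ballI allI impI)
    show "openin (pullback_topology A e P) V" if "V \<in> range (\<lambda>n. e -` b n \<inter> A)" for V
      using that b(1) by (auto simp: openin_pullback_topology)
    fix U x assume "openin (pullback_topology A e P) U \<and> x \<in> U"
    then obtain N where N: "openin P N" "U = e -` N \<inter> A" "e x \<in> N" "x \<in> A"
      by (auto simp: openin_pullback_topology)
    then obtain n where "e x \<in> b n" "b n \<subseteq> N" using b(2) by meson
    then show "\<exists>V\<in>range (\<lambda>n. e -` b n \<inter> A). x \<in> V \<and> V \<subseteq> U"
      using N by (intro bexI[of _ "e -` b n \<inter> A"]) auto
  qed
  then show ?thesis unfolding second_countable_iff_base by (intro exI conjI) (assumption, simp)
qed

text \<open>The functions \<open>e a\<close> are glued along the sets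
  \<open>U a \<times> topspace TH\<close> into one \<open>?F\<close>, which factors as
  \<open>g\<close> after \<open>h\<close>. Since \<open>h (p a, y)\<close> is the product of
  \<open>h (p a, \<one>)\<close> and \<open>h (\<one>, y)\<close>, each \<open>e a\<close> is a
  translate of \<open>g\<close> composed with \<open>k\<close>, hence continuous for the topology
  pulled back along \<open>k\<close>.\<close>

lemma r_factorizable_product_imp_functions_factor:
  fixes G :: "('a, 'm) monoid_scheme" and H :: "('b, 'n) monoid_scheme"
  assumes G: "topological_group G T" and H: "topological_group H TH"
    and U: "disjoint_locally_finite T (Field omega1) U" and p: "\<And>a. a \<in> Field omega1 \<Longrightarrow> p a \<in> U a"
    and R: "r_factorizable (G \<times>\<times> H) (prod_topology T TH)"
  shows "omega1_functions_factor TH"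
  unfolding omega1_functions_factor_def
proof (intro allI impI, elim conjE)
  fix \<F> :: "('b \<Rightarrow> real) set" assume F: "|\<F>| \<le>o omega1" "\<forall>f\<in>\<F>. continuous_map TH euclideanreal f"
  interpret G: group G using G by (simp add: topological_group_def)
  interpret H: group H using H by (simp add: topological_group_def)
  have top: "topspace T = carrier G" "topspace TH = carrier H"
    using G H by (auto simp: topological_group_def)
  have UT: "openin T (U a)" if "a \<in> Field omega1" for a
    by (rule disjoint_locally_finiteD(1)[OF U that])
  have pG: "p a \<in> carrier G" if "a \<in> Field omega1" for a
    using openin_subset[OF UT[OF that]] p[OF that] top by blast
  obtain e where e: "\<forall>a\<in>Field omega1. continuous_map TH euclideanreal (e a)" "\<F> \<subseteq> e ` Field omega1"
  proof (cases "\<F> = {}")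
    case True
    then show thesis using that[of "\<lambda>_ _. 0"] by simp
  next
    case False
    obtain e where e: "e ` Field omega1 = \<F>" using omega1_enumerates[OF F(1) False] by blast
    have "\<forall>a\<in>Field omega1. continuous_map TH euclideanreal (e a)" using F(2) unfolding e[symmetric] by simp
    then show thesis using e that by blast
  qed
  have "completely_regular_space T" using G by (simp add: topological_group_def)
  then have "\<exists>f. continuous_map T euclideanreal f \<and> f (p a) = 1 \<and> (\<forall>y\<in>topspace T - U a. f y = 0)"
    if "a \<in> Field omega1" for a
    using completely_regular_bump[OF _ UT[OF that] p[OF that]] by blast
  then obtain \<phi> where \<phi>: "\<And>a. a \<in> Field omega1 \<Longrightarrow> continuous_map T euclideanreal (\<phi> a) \<and> \<phi> a (p a) = 1 \<and>
      (\<forall>y\<in>topspace T - U a. \<phi> a y = 0)"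
    by metis
  let ?U = "\<lambda>a. U a \<times> topspace TH"
  let ?F = "glue (Field omega1) ?U (\<lambda>a z. \<phi> a (fst z) * e a (snd z))"
  have Ux: "disjoint_locally_finite (prod_topology T TH) (Field omega1) ?U"
    by (rule disjoint_locally_finite_Times[OF U])
  have "continuous_map (prod_topology T TH) euclideanreal ?F"
  proof (rule continuous_map_glue[OF Ux])
    fix a assume a: "a \<in> Field omega1"
    have "continuous_map (prod_topology T TH) euclideanreal (\<phi> a \<circ> fst)"
      by (rule continuous_map_compose[OF continuous_map_fst]) (use \<phi>[OF a] in blast)
    moreover have "continuous_map (prod_topology T TH) euclideanreal (e a \<circ> snd)"
      by (rule continuous_map_compose[OF continuous_map_snd]) (use e(1) a in blast)
    ultimately show "continuous_map (prod_topology T TH) euclideanreal (\<lambda>z. \<phi> a (fst z) * e a (snd z))"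
      by (intro continuous_map_real_mult) (simp_all add: comp_def)
    show "\<phi> a (fst z) * e a (snd z) = 0" if "z \<in> topspace (prod_topology T TH) - ?U a" for z
    proof -
      have "fst z \<in> topspace T - U a" using that by (cases z) auto
      then show ?thesis using \<phi>[OF a] by simp
    qed
  qed
  then obtain K :: "real monoid" and TK h g where K: "topological_group K TK" "second_countable TK"
    and h: "h \<in> hom (G \<times>\<times> H) K" "continuous_map (prod_topology T TH) TK h"
    and g: "continuous_map TK euclideanreal g" "\<forall>x\<in>carrier (G \<times>\<times> H). ?F x = g (h x)"
    using R unfolding r_factorizable_def factors_through_def by meson
  interpret K: group K using K by (simp add: topological_group_def)
  have topK: "topspace TK = carrier K" using K by (simp add: topological_group_def)
  define k where "k y = h (\<one>\<^bsub>G\<^esub>, y)" for y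
  define Z where "Z = pullback_topology (carrier H) k TK"
  have hcar: "h (x, y) \<in> carrier K" if "x \<in> carrier G" "y \<in> carrier H" for x y
    using h(1) that by (auto simp: hom_def Pi_def)
  have topZ: "topspace Z = topspace TH"
    by (auto simp: Z_def topspace_pullback_topology top topK k_def hcar)
  have "continuous_map TH (prod_topology T TH) (\<lambda>y. (\<one>\<^bsub>G\<^esub>, y))"
    by (simp add: continuous_map_pairwise comp_def top)
  from continuous_map_compose[OF this h(2)] have kTH: "continuous_map TH TK k"
    by (simp add: comp_def k_def[abs_def])
  have coarser: "openin TH V" if "openin Z V" for V
  proof -
    obtain N where N: "openin TK N" "V = k -` N \<inter> carrier H"
      using \<open>openin Z V\<close> by (auto simp: Z_def openin_pullback_topology)
    have "V = {y \<in> topspace TH. k y \<in> N}" using N(2) top by auto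
    then show ?thesis using openin_continuous_map_preimage[OF kTH N(1)] by simp
  qed
  have "continuous_map Z TK (id \<circ> k)"
    unfolding Z_def by (rule continuous_map_pullback[OF continuous_map_id])
  then have kZ: "continuous_map Z TK k" by simp
  have "continuous_map Z euclideanreal f" if f: "f \<in> \<F>" for f
  proof -
    obtain a where a: "a \<in> Field omega1" "f = e a" using e(2) f by blast
    have "continuous_map TK TK (\<lambda>x. h (p a, \<one>\<^bsub>H\<^esub>) \<otimes>\<^bsub>K\<^esub> x)"
      by (rule coarser_group_topology_translation[OF K.is_group topological_group_imp_coarser[OF K(1)]])
        (simp add: hcar pG a)
    from continuous_map_compose[OF continuous_map_compose[OF kZ this] g(1)]
    show ?thesis
    proof (rule continuous_map_eq)
      fix y assume "y \<in> topspace Z"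
      then have y: "y \<in> carrier H" using topZ top by simp
      have "h (p a, \<one>\<^bsub>H\<^esub>) \<otimes>\<^bsub>K\<^esub> k y = h (p a, y)"
        unfolding k_def using pG[OF a(1)] y by (subst hom_mult[OF h(1), symmetric]) simp_all
      then have "(g \<circ> ((\<lambda>x. h (p a, \<one>\<^bsub>H\<^esub>) \<otimes>\<^bsub>K\<^esub> x) \<circ> k)) y = ?F (p a, y)"
        using g(2) pG[OF a(1)] y by simp
      also have "\<dots> = \<phi> a (p a) * e a y"
        using glue_inside[OF disjoint_locally_finiteD(2)[OF Ux] a(1), of "(p a, y)"] p[OF a(1)] y top by simp
      finally show "(g \<circ> ((\<lambda>x. h (p a, \<one>\<^bsub>H\<^esub>) \<otimes>\<^bsub>K\<^esub> x) \<circ> k)) y = f y"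
        using \<phi>[OF a(1)] a(2) by simp
    qed
  qed
  moreover have "second_countable Z" unfolding Z_def by (rule second_countable_pullback[OF K(2)])
  ultimately show "\<exists>Z. topspace Z = topspace TH \<and> (\<forall>V. openin Z V \<longrightarrow> openin TH V) \<and> second_countable Z \<and>
      (\<forall>f\<in>\<F>. continuous_map Z euclideanreal f)"
    using topZ coarser by (intro exI[of _ Z] conjI allI impI ballI)
qed

text \<open>Every open set of \<open>X\<close> is a union of superlevel sets of members of
  \<open>\<F>\<close>, so the second-countable topology \<open>Z\<close> that makes
  \<open>\<F>\<close> continuous is \<open>X\<close> itself.\<close>

lemma functions_factor_imp_second_countable:
  assumes X: "omega1_functions_factor X" and F: "|\<F>| \<le>o omega1" "\<forall>f\<in>\<F>. continuous_map X euclideanreal f"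
    and sep: "\<forall>U x. openin X U \<and> x \<in> U \<longrightarrow> (\<exists>f\<in>\<F>. f x > 1/2 \<and> (\<forall>y\<in>topspace X - U. f y = 0))"
  shows "second_countable X"
proof -
  obtain Z where Z: "topspace Z = topspace X" "\<forall>V. openin Z V \<longrightarrow> openin X V" "second_countable Z"
    "\<forall>f\<in>\<F>. continuous_map Z euclideanreal f"
    using X F unfolding omega1_functions_factor_def by meson
  have "openin Z U" if U: "openin X U" for U
  proof (subst openin_subopen, intro ballI)
    fix x assume x: "x \<in> U"
    then obtain f where f: "f \<in> \<F>" "f x > 1/2" "\<forall>y\<in>topspace X - U. f y = 0" using sep U by blast
    let ?N = "{y \<in> topspace Z. f y > 1/2}"
    have "openin Z ?N" using Z(4) f(1) openin_superlevel by blast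
    moreover have "x \<in> ?N" using f(2) x openin_subset[OF U] Z(1) by auto
    moreover have "?N \<subseteq> U"
    proof
      fix y assume "y \<in> ?N"
      then have "y \<in> topspace X" "f y \<noteq> 0" using Z(1) by auto
      then show "y \<in> U" using f(3) by blast
    qed
    ultimately show "\<exists>N. openin Z N \<and> x \<in> N \<and> N \<subseteq> U" by blast
  qed
  then have "Z = X" using Z(2) by (auto simp: topology_eq)
  then show ?thesis using Z(3) by simp
qed

text \<open>Each \<open>V a\<close> contains a box \<open>B a\<close> around \<open>y a\<close>. The
  bumps for all sides of all boxes are at most \<open>omega1\<close> many, so one second-countable
  \<open>Z\<close> has basic sets \<open>b (n a i)\<close> between \<open>y a i\<close> and
  \<open>B a i\<close>. The code \<open>c a\<close> lists the finitely many constrained coordinates;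
  there are countably many codes, and equal codes put both points into both boxes.\<close>

lemma functions_factor_product_no_separated_family:
  assumes X: "omega1_functions_factor X" and creg: "completely_regular_space X"
    and V: "\<And>a. a \<in> Field omega1 \<Longrightarrow> openin (product_topology (\<lambda>_ :: nat. X) UNIV) (V a) \<and> y a \<in> V a"
    and sep: "\<And>a b. \<lbrakk>a \<in> Field omega1; b \<in> Field omega1; a \<noteq> b\<rbrakk> \<Longrightarrow> y a \<notin> V b \<or> y b \<notin> V a"
  shows False
proof -
  have "\<exists>B. finite {i. B i \<noteq> topspace X} \<and> (\<forall>i. openin X (B i)) \<and> y a \<in> Pi\<^sub>E UNIV B \<and> Pi\<^sub>E UNIV B \<subseteq> V a"
    if "a \<in> Field omega1" for a
    using V[OF that] unfolding openin_product_topology_alt by simp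
  then obtain B where B: "\<And>a. a \<in> Field omega1 \<Longrightarrow> finite {i. B a i \<noteq> topspace X} \<and> (\<forall>i. openin X (B a i)) \<and>
      y a \<in> Pi\<^sub>E UNIV (B a) \<and> Pi\<^sub>E UNIV (B a) \<subseteq> V a"
    by metis
  have yB: "y a i \<in> B a i" if "a \<in> Field omega1" for a i
    using B[OF that] by (auto simp: PiE_def Pi_def)
  have "\<exists>f. continuous_map X euclideanreal f \<and> f (y a i) = 1 \<and> (\<forall>z\<in>topspace X - B a i. f z = 0)"
    if "a \<in> Field omega1" for a i
    using completely_regular_bump[OF creg _ yB[OF that]] B[OF that] by blast
  then obtain f where f: "\<And>a i. a \<in> Field omega1 \<Longrightarrow> continuous_map X euclideanreal (f a i) \<and> f a i (y a i) = 1 \<and>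
      (\<forall>z\<in>topspace X - B a i. f a i z = 0)"
    by metis
  let ?F = "(\<lambda>(a, i). f a i) ` (Field omega1 \<times> (UNIV :: nat set))"
  have "|Field omega1 \<times> (UNIV :: nat set)| \<le>o omega1"
    by (intro card_of_Times_le_omega1 countable_imp_le_omega1 ordIso_imp_ordLeq[OF card_of_Field_omega1]) simp
  then have cF: "|?F| \<le>o omega1"
    by (rule ordLeq_transitive[OF card_of_image])
  have "\<forall>g\<in>?F. continuous_map X euclideanreal g" using f by auto
  then obtain Z where Z: "topspace Z = topspace X" "second_countable Z" "\<forall>g\<in>?F. continuous_map Z euclideanreal g"
    using X cF unfolding omega1_functions_factor_def by meson
  obtain b :: "nat \<Rightarrow> 'a set" where b: "\<forall>n. openin Z (b n)"
    "\<forall>U x. openin Z U \<and> x \<in> U \<longrightarrow> (\<exists>n. x \<in> b n \<and> b n \<subseteq> U)"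
    using second_countable_enum_base[OF Z(2)] by (elim exE conjE)
  have "\<exists>n. y a i \<in> b n \<and> b n \<subseteq> B a i" if a: "a \<in> Field omega1" for a i
  proof -
    let ?N = "{z \<in> topspace Z. f a i z > 1/2}"
    have "openin Z ?N" using Z(3) a by (intro openin_superlevel) auto
    moreover have "y a i \<in> ?N"
      using f[OF a, of i] yB[OF a, of i] B[OF a] Z(1) openin_subset by fastforce
    ultimately obtain n where n: "y a i \<in> b n" "b n \<subseteq> ?N" using b(2) by meson
    have "?N \<subseteq> B a i"
    proof
      fix z assume "z \<in> ?N"
      then have "z \<in> topspace X" "f a i z \<noteq> 0" using Z(1) by auto
      then show "z \<in> B a i" using f[OF a] by blast
    qed
    then show ?thesis using n by blast
  qed
  then obtain n where n: "\<And>a i. a \<in> Field omega1 \<Longrightarrow> y a i \<in> b (n a i) \<and> b (n a i) \<subseteq> B a i" by metis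
  define c where "c a = (\<lambda>i. (i, n a i)) ` {i. B a i \<noteq> topspace X}" for a
  \<comment> \<open>One inclusion of codes is enough: at the constrained coordinates of
    \<open>B a\<close> both points lie in the same basic set, and at the others the side of the box
    is the whole space.\<close>
  have mem: "y a' \<in> V a" if a: "a \<in> Field omega1" "a' \<in> Field omega1" "c a \<subseteq> c a'" for a a'
  proof -
    have "y a' i \<in> B a i" for i
    proof (cases "B a i = topspace X")
      case True
      then show ?thesis using yB[OF a(2), of i] B[OF a(2)] openin_subset by blast
    next
      case False
      then have "(i, n a i) \<in> c a'" using a(3) by (auto simp: c_def)
      then have "n a' i = n a i" by (auto simp: c_def)
      then show ?thesis using n[OF a(1), of i] n[OF a(2), of i] by auto
    qed
    then show ?thesis using B[OF a(1)] by (auto simp: PiE_def)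
  qed
  have "inj_on c (Field omega1)"
  proof (rule inj_onI, rule ccontr)
    fix a a' assume "a \<in> Field omega1" "a' \<in> Field omega1" "c a = c a'" "a \<noteq> a'"
    then show False using sep[of a a'] mem[of a a'] mem[of a' a] by simp
  qed
  moreover have "countable (c ` Field omega1)"
  proof (rule countable_subset)
    show "c ` Field omega1 \<subseteq> Fpow UNIV" using B by (auto simp: c_def Fpow_def)
    show "countable (Fpow (UNIV :: (nat \<times> nat) set))" by (intro countable_Fpow) simp
  qed
  ultimately show False using uncountable_Field_omega1 countable_image_inj_on by blast
qed

section \<open>Hereditary Lindelof property, hereditary separability and the number of continuous
  functions\<close>

lemma hereditarily_Lindelof_separableI:
  assumes nosep: "\<And>y V. \<lbrakk>\<And>a. a \<in> Field omega1 \<Longrightarrow> openin Y (V a) \<and> y a \<in> V a;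
      \<And>a b. \<lbrakk>a \<in> Field omega1; b \<in> Field omega1; a \<noteq> b\<rbrakk> \<Longrightarrow> y a \<notin> V b \<or> y b \<notin> V a\<rbrakk> \<Longrightarrow> False"
  shows "hereditarily Lindelof_space Y" "hereditarily separable_space Y"
proof -
  have "Lindelof_space (subtopology Y S)" if S: "S \<subseteq> topspace Y" for S
    unfolding Lindelof_space_def
  proof (intro allI impI, rule ccontr)
    fix \<U> assume U: "(\<forall>U\<in>\<U>. openin (subtopology Y S) U) \<and> \<Union>\<U> = topspace (subtopology Y S)"
      and contr: "\<nexists>\<V>. countable \<V> \<and> \<V> \<subseteq> \<U> \<and> \<Union>\<V> = topspace (subtopology Y S)"
    have US: "\<Union>\<U> = S" using U S by (simp add: inf.absorb2)
    \<comment> \<open>The pair \<open>r\<close> is a point of \<open>S\<close> outside all earlier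
      chosen members of the cover, together with a member around it. Such a point exists as long as
      there is no countable subcover, and the recursion yields a right-separated sequence.\<close>
    define P where "P f b r \<longleftrightarrow> (fst r \<in> S \<and> snd r \<in> \<U> \<and> fst r \<in> snd r \<and> (\<forall>a\<in>underS omega1 b. fst r \<notin> snd (f a)))"
      for f :: "nat set \<Rightarrow> 'a \<times> 'a set" and b r
    have "\<exists>f. \<forall>b. P f b (f b)"
    proof (rule dependent_wf_choice[OF wf_omega1])
      fix f g :: "nat set \<Rightarrow> 'a \<times> 'a set" and b r
      assume "\<And>z. (z, b) \<in> omega1 - Id \<Longrightarrow> f z = g z"
      then have "\<forall>a\<in>underS omega1 b. f a = g a" by (auto simp: underS_def)
      then show "P f b r = P g b r" by (simp add: P_def)
    next
      fix b and f :: "nat set \<Rightarrow> 'a \<times> 'a set"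
      assume IH: "\<And>a. (a, b) \<in> omega1 - Id \<Longrightarrow> P f a (f a)"
      let ?V = "(\<lambda>a. snd (f a)) ` underS omega1 b"
      have "snd (f a) \<in> \<U>" if "a \<in> underS omega1 b" for a
        using IH[of a] that by (auto simp: P_def underS_def)
      then have sub: "?V \<subseteq> \<U>" by blast
      moreover have "countable ?V" using countable_underS_omega1 by simp
      ultimately have "\<Union>?V \<noteq> S" using contr S by (auto simp: inf.absorb2)
      moreover have "\<Union>?V \<subseteq> S" using sub US by blast
      ultimately obtain x where x: "x \<in> S" "x \<notin> \<Union>?V" by blast
      then obtain N where "N \<in> \<U>" "x \<in> N" using US by blast
      then have "P f b (x, N)" using x by (auto simp: P_def)
      then show "\<exists>r. P f b r" by blast
    qed
    then obtain f where f: "\<And>b. P f b (f b)" by blast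
    have "\<exists>V. openin Y V \<and> snd (f a) = V \<inter> S" for a
    proof -
      have "snd (f a) \<in> \<U>" using f[of a] by (simp add: P_def)
      then show ?thesis using U by (auto simp: openin_subtopology)
    qed
    then obtain V where V: "\<And>a. openin Y (V a) \<and> snd (f a) = V a \<inter> S" by metis
    have later: "fst (f b) \<notin> V a" if "a \<in> underS omega1 b" for a b
    proof -
      have "fst (f b) \<in> S" "fst (f b) \<notin> snd (f a)" using f[of b] that by (simp_all add: P_def)
      then show ?thesis using V[of a] by blast
    qed
    show False
    proof (rule nosep[of V "\<lambda>a. fst (f a)"])
      show "openin Y (V a) \<and> fst (f a) \<in> V a" for a
      proof -
        have "fst (f a) \<in> snd (f a)" using f[of a] by (simp add: P_def)
        then show ?thesis using V[of a] by blast
      qed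
      show "fst (f a) \<notin> V b \<or> fst (f b) \<notin> V a" if "a \<in> Field omega1" "b \<in> Field omega1" "a \<noteq> b" for a b
        using underS_omega1_total[OF that] later by blast
    qed
  qed
  then show "hereditarily Lindelof_space Y" by (simp add: hereditarily_def)
next
  have "separable_space (subtopology Y S)" if S: "S \<subseteq> topspace Y" for S
  proof (rule ccontr)
    assume contr: "\<not> separable_space (subtopology Y S)"
    have topS: "topspace (subtopology Y S) = S" using S by (simp add: inf.absorb2)
    \<comment> \<open>A point outside the closure of the countably many earlier ones exists because
      those are not dense; its neighbourhood missing them makes the sequence left-separated.\<close>
    define P where "P f b r \<longleftrightarrow> (r \<in> S \<and> r \<notin> subtopology Y S closure_of (f ` underS omega1 b))"
      for f :: "nat set \<Rightarrow> 'a" and b r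
    have "\<exists>f. \<forall>b. P f b (f b)"
    proof (rule dependent_wf_choice[OF wf_omega1])
      fix f g :: "nat set \<Rightarrow> 'a" and b r
      assume "\<And>z. (z, b) \<in> omega1 - Id \<Longrightarrow> f z = g z"
      then have "f ` underS omega1 b = g ` underS omega1 b" by (auto simp: underS_def)
      then show "P f b r = P g b r" by (simp add: P_def)
    next
      fix b and f :: "nat set \<Rightarrow> 'a"
      assume IH: "\<And>a. (a, b) \<in> omega1 - Id \<Longrightarrow> P f a (f a)"
      let ?C = "f ` underS omega1 b"
      have "f a \<in> S" if "a \<in> underS omega1 b" for a
        using IH[of a] that by (auto simp: P_def underS_def)
      then have "?C \<subseteq> topspace (subtopology Y S)" using topS by auto
      moreover have "countable ?C" using countable_underS_omega1 by simp
      ultimately have "subtopology Y S closure_of ?C \<noteq> S"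
        using contr topS unfolding separable_space_def by blast
      moreover have "subtopology Y S closure_of ?C \<subseteq> S"
        using closure_of_subset_topspace[of "subtopology Y S" ?C] topS by simp
      ultimately show "\<exists>r. P f b r" unfolding P_def by blast
    qed
    then obtain f where f: "\<And>b. P f b (f b)" by blast
    have fS: "f b \<in> S" for b using f[of b] by (simp add: P_def)
    have "\<exists>V. openin Y V \<and> f b \<in> V \<and> (\<forall>a\<in>underS omega1 b. f a \<notin> V)" for b
    proof -
      have "f b \<in> topspace (subtopology Y S)" "f b \<notin> subtopology Y S closure_of (f ` underS omega1 b)"
        using f[of b] topS by (simp_all add: P_def)
      then obtain N where N: "f b \<in> N" "openin (subtopology Y S) N" "\<forall>a\<in>underS omega1 b. f a \<notin> N"
        unfolding in_closure_of by blast
      then obtain V where "openin Y V" "N = V \<inter> S" by (auto simp: openin_subtopology)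
      then show ?thesis using N fS by blast
    qed
    then obtain V where V: "\<And>b. openin Y (V b) \<and> f b \<in> V b \<and> (\<forall>a\<in>underS omega1 b. f a \<notin> V b)" by metis
    show False
    proof (rule nosep[of V f])
      show "openin Y (V a) \<and> f a \<in> V a" for a using V by blast
      show "f a \<notin> V b \<or> f b \<notin> V a" if "a \<in> Field omega1" "b \<in> Field omega1" "a \<noteq> b" for a b
        using underS_omega1_total[OF that] V by blast
    qed
  qed
  then show "hereditarily separable_space Y" by (simp add: hereditarily_def)
qed

text \<open>A continuous function is determined by its values on a countable dense \<open>D\<close>,
  and these by the rationals below them, so a set of pairs from \<open>nat \<times> rat\<close>
  codes it. Restriction identifies functions that differ only outside the space.\<close>

lemma separable_imp_continuous_functions_le_continuum:
  assumes X: "separable_space X"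
  shows "|(\<lambda>f. restrict f (topspace X)) ` {f. continuous_map X euclideanreal f}| \<le>o |UNIV :: real set|"
proof -
  obtain D where D: "countable D" "D \<subseteq> topspace X" "X closure_of D = topspace X"
    using X unfolding separable_space_def by (elim exE conjE)
  let ?C = "(\<lambda>f. restrict f (topspace X)) ` {f. continuous_map X euclideanreal f}"
  define c where "c f = (\<lambda>(d, q). (to_nat_on D d, q)) ` {(d, q). d \<in> D \<and> real_of_rat q < f d}" for f
  have "inj_on c ?C"
  proof (rule inj_onI)
    fix f g assume fg: "f \<in> ?C" "g \<in> ?C" "c f = c g"
    have cont: "continuous_map X euclideanreal f" "continuous_map X euclideanreal g"
      using fg(1,2) by (auto intro: continuous_map_eq)
    have mem: "(to_nat_on D d, q) \<in> c h \<longleftrightarrow> real_of_rat q < h d" if "d \<in> D" for h d q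
      using D(1) that by (auto simp: c_def)
    have "f d = g d" if d: "d \<in> D" for d
    proof (rule ccontr)
      assume "f d \<noteq> g d"
      then consider "f d < g d" | "g d < f d" by linarith
      then obtain q where "(real_of_rat q < f d) \<noteq> (real_of_rat q < g d)"
        by cases (meson of_rat_dense less_asym)+
      then show False using mem[OF d, of q f] mem[OF d, of q g] fg(3) by simp
    qed
    then have "f x = g x" if "x \<in> topspace X" for x
      using forall_in_closure_of_eq[of x X D euclideanreal f g] cont that D(3) by simp
    then show "f = g" using fg(1,2) by (auto simp: restrict_def fun_eq_iff)
  qed
  then have "|?C| \<le>o |UNIV :: (nat \<times> rat) set set|"
    by (intro card_of_ordLeqI[of c]) auto
  also have "|UNIV :: (nat \<times> rat) set set| \<le>o |UNIV :: nat set set|"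
    by (rule card_of_ordLeqI[of "\<lambda>A. to_nat ` A"]) (auto intro: inj_onI simp: inj_image_eq_iff)
  also have "|UNIV :: nat set set| =o |UNIV :: real set|"
    using nat_sets_eqpoll_reals by (simp add: eqpoll_iff_card_of_ordIso)
  finally show ?thesis .
qed

section \<open>Consequences for weird groups and for the second factor\<close>

lemma weird_imp_r_factorizable_family:
  assumes "weird_r_factorizable G T"
  obtains U p where "r_factorizable_family G T U p"
proof -
  have w: "topological_group G T" "r_factorizable G T" "\<not> pseudo_aleph1_compact T"
    using assms by (auto simp: weird_r_factorizable_def)
  obtain U where U: "disjoint_locally_finite T (Field omega1) U" "\<forall>a\<in>Field omega1. U a \<noteq> {}"
    using not_pseudo_aleph1_compact_imp_family[OF w(3)] by (elim exE conjE)
  have "group G" using w(1) by (simp add: topological_group_def)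
  then have "r_factorizable_family G T U (\<lambda>a. SOME x. x \<in> U a)"
    using w U by (simp add: r_factorizable_family_def r_factorizable_family_axioms_def some_in_eq)
  then show thesis by (rule that)
qed

context r_factorizable_family
begin

text \<open>The cylinders over \<open>U a\<close> in coordinate 0, with the constant sequences at
  \<open>p a\<close>, form a separated family in the countable power. Taking \<open>G\<close> as the
  second factor, this refutes factorizability of the square.\<close>

lemma not_omega1_functions_factor: "\<not> omega1_functions_factor T"
proof
  let ?Y = "product_topology (\<lambda>_ :: nat. T) UNIV"
  assume "omega1_functions_factor T"
  then show False
  proof (rule functions_factor_product_no_separated_family[OF _ creg])
    show "openin ?Y {z \<in> topspace ?Y. z 0 \<in> U a} \<and> (\<lambda>_. p a) \<in> {z \<in> topspace ?Y. z 0 \<in> U a}"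
      if a: "a \<in> Field omega1" for a
    proof
      show "openin ?Y {z \<in> topspace ?Y. z 0 \<in> U a}"
        by (rule openin_continuous_map_preimage[OF _ U_open[OF a]], rule continuous_map_product_coordinates) simp
      show "(\<lambda>_. p a) \<in> {z \<in> topspace ?Y. z 0 \<in> U a}" using p[OF a] a by (simp add: PiE_def)
    qed
    show "(\<lambda>_. p a) \<notin> {z \<in> topspace ?Y. z 0 \<in> U b} \<or> (\<lambda>_. p b) \<notin> {z \<in> topspace ?Y. z 0 \<in> U a}"
      if "a \<in> Field omega1" "b \<in> Field omega1" "a \<noteq> b" for a b
      using disjoint_family_onD[OF U_disjoint that] p[OF that(1)] by auto
  qed
qed

lemma omega1_less_weight: "omega1 <o weight T"
proof -
  obtain \<B> where B: "is_base T \<B>" "weight T = |\<B>|" using weight_attained by blast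
  then show ?thesis using no_small_base[OF B(1)] omega1_less_iff_not_le by auto
qed

lemma ctwo_cexp_omega1_le_weight: "ctwo ^c omega1 \<le>o weight T ^c natLeq"
proof -
  obtain \<B> where B: "is_base T \<B>" "weight T = |\<B>|" using weight_attained by blast
  then show ?thesis using ctwo_cexp_omega1_le[OF B(1)] by simp
qed

end

text \<open>A base of size at most \<open>omega1\<close> yields at most \<open>omega1\<close>
  functions that determine the topology.\<close>

lemma functions_factor_weight_imp_second_countable:
  assumes X: "omega1_functions_factor X" "completely_regular_space X" and w: "weight X \<le>o omega1"
  shows "second_countable X"
proof -
  obtain \<B> where B: "is_base X \<B>" "weight X = |\<B>|" using weight_attained by blast
  have "|\<B>| \<le>o omega1" using w B(2) by simp
  then have "|\<B> \<times> \<B>| \<le>o omega1"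
    by (intro card_of_Times_le_omega1)
  moreover obtain \<F> where F: "|\<F>| \<le>o |\<B> \<times> \<B>|" "\<forall>f\<in>\<F>. continuous_map X euclideanreal f"
    "\<forall>U x. openin X U \<and> x \<in> U \<longrightarrow> (\<exists>f\<in>\<F>. f x > 1/2 \<and> (\<forall>y\<in>topspace X - U. f y = 0))"
    by (rule completely_regular_base_functions[OF X(2) B(1)])
  ultimately show ?thesis
    using functions_factor_imp_second_countable[OF X(1) _ F(2,3)] ordLeq_transitive by blast
qed

text \<open>Under CH a separable space carries at most \<open>omega1\<close> continuous real
  functions, so all of them factor at once.\<close>

lemma functions_factor_separable_CH_imp_second_countable:
  assumes X: "omega1_functions_factor X" "completely_regular_space X" "separable_space X"
    and CH: continuum_hypothesis
  shows "second_countable X"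
proof (rule functions_factor_imp_second_countable[OF X(1)])
  let ?C = "(\<lambda>f. restrict f (topspace X)) ` {f. continuous_map X euclideanreal f}"
  show "|?C| \<le>o omega1"
    using separable_imp_continuous_functions_le_continuum[OF X(3)] CH
    unfolding continuum_hypothesis_def by (rule ordLeq_ordIso_trans)
  show "\<forall>f\<in>?C. continuous_map X euclideanreal f"
    by (auto intro: continuous_map_eq)
  show "\<forall>U x. openin X U \<and> x \<in> U \<longrightarrow> (\<exists>f\<in>?C. f x > 1/2 \<and> (\<forall>y\<in>topspace X - U. f y = 0))"
  proof (intro allI impI, elim conjE)
    fix U x assume U: "openin X U" "x \<in> U"
    obtain f where f: "continuous_map X euclideanreal f" "f x = 1" "\<forall>y\<in>topspace X - U. f y = 0"
      using completely_regular_bump[OF X(2) U] by (elim exE conjE)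
    have "x \<in> topspace X" using U openin_subset by blast
    then show "\<exists>f\<in>?C. f x > 1/2 \<and> (\<forall>y\<in>topspace X - U. f y = 0)"
      using f by (intro bexI[of _ "restrict f (topspace X)"]) auto
  qed
qed

lemma functions_factor_imp_power_hereditarily:
  assumes X: "omega1_functions_factor X" "completely_regular_space X"
  shows "hereditarily Lindelof_space (product_topology (\<lambda>_ :: nat. X) UNIV)"
    and "hereditarily separable_space (product_topology (\<lambda>_ :: nat. X) UNIV)"
  by (rule hereditarily_Lindelof_separableI, rule functions_factor_product_no_separated_family[OF X], assumption+)+

lemma separable_factor_of_power:
  assumes "hereditarily separable_space (product_topology (\<lambda>_ :: nat. X) UNIV)"
  shows "separable_space X"
proof -
  let ?Y = "product_topology (\<lambda>_ :: nat. X) UNIV"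
  have "separable_space ?Y"
    using assms unfolding hereditarily_def by (metis subset_refl subtopology_topspace)
  moreover have "continuous_map ?Y X (\<lambda>z. z 0)" by (rule continuous_map_product_coordinates) simp
  moreover have "(\<lambda>z. z 0) ` topspace ?Y = topspace X"
  proof (intro equalityI subsetI)
    fix x assume "x \<in> topspace X"
    then have "(\<lambda>_. x) \<in> topspace ?Y" by (simp add: PiE_def)
    then show "x \<in> (\<lambda>z. z 0) ` topspace ?Y" by (intro image_eqI[of _ _ "\<lambda>_. x"]) simp_all
  qed auto
  ultimately show ?thesis by (rule separable_space_continuous_map_image)
qed

theorem theorem1:
  fixes G :: "'a monoid" and T :: "'a topology"
  assumes "weird_r_factorizable G T"
  shows
    "\<not> r_factorizable (G \<times>\<times> G) (prod_topology T T) \<and>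
     (\<exists>(K :: 'a monoid) TK h.
        topological_group K TK \<and> h \<in> hom G K \<and> continuous_map T TK h \<and>
        h ` carrier G = carrier K \<and> \<not> r_factorizable K TK) \<and>
     omega1 <o weight T \<and>
     ctwo ^c omega1 \<le>o weight T ^c natLeq \<and>
     (pseudocharacter T \<le>o natLeq \<and> submetrizable T) \<and>
     (\<forall>(H :: 'b monoid) TH.
        topological_group H TH \<and> r_factorizable (G \<times>\<times> H) (prod_topology T TH) \<longrightarrow>
          (hereditarily Lindelof_space (product_topology (\<lambda>_ :: nat. TH) UNIV) \<and>
           hereditarily separable_space (product_topology (\<lambda>_ :: nat. TH) UNIV)) \<and>
          (weight TH \<le>o omega1 \<longrightarrow> second_countable TH) \<and>
          (continuum_hypothesis \<longrightarrow> second_countable TH))"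
proof -
  obtain U p where "r_factorizable_family G T U p"
    by (rule weird_imp_r_factorizable_family[OF assms])
  then interpret r_factorizable_family G T U p .
  have 1: "\<not> r_factorizable (G \<times>\<times> G) (prod_topology T T)"
    using r_factorizable_product_imp_functions_factor[OF tg tg family p] not_omega1_functions_factor by blast
  obtain J where J: "coarser_group_topology G T J" "topological_group G J" "\<not> r_factorizable G J"
    by (rule coarser_not_r_factorizable)
  \<comment> \<open>As \<open>J\<close> coarsens \<open>T\<close> on the same group, the identity is
    the required surjective homomorphism.\<close>
  have "continuous_map T J id"
    using coarser_group_topologyD[OF J(1)]
    by (intro continuous_map_finer_domain[of J J id T] continuous_map_id) simp_all
  then have 2: "\<exists>(K :: 'a monoid) TK h.
        topological_group K TK \<and> h \<in> hom G K \<and> continuous_map T TK h \<and>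
        h ` carrier G = carrier K \<and> \<not> r_factorizable K TK"
    using J(2,3) by (intro exI[of _ G] exI[of _ J] exI[of _ id]) (simp add: hom_def)
  have 6: "(hereditarily Lindelof_space (product_topology (\<lambda>_ :: nat. TH) UNIV) \<and>
           hereditarily separable_space (product_topology (\<lambda>_ :: nat. TH) UNIV)) \<and>
          (weight TH \<le>o omega1 \<longrightarrow> second_countable TH) \<and>
          (continuum_hypothesis \<longrightarrow> second_countable TH)"
    if H: "topological_group H TH" "r_factorizable (G \<times>\<times> H) (prod_topology T TH)"
    for H :: "'b monoid" and TH
  proof -
    have f: "omega1_functions_factor TH"
      by (rule r_factorizable_product_imp_functions_factor[OF tg H(1) family p H(2)])
    have c: "completely_regular_space TH" using H(1) by (simp add: topological_group_def)
    note hs = functions_factor_imp_power_hereditarily(2)[OF f c]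
    show ?thesis
      using functions_factor_imp_power_hereditarily(1)[OF f c] hs
        functions_factor_weight_imp_second_countable[OF f c]
        functions_factor_separable_CH_imp_second_countable[OF f c separable_factor_of_power[OF hs]]
      by blast
  qed
  show ?thesis
    using 1 2 6 omega1_less_weight ctwo_cexp_omega1_le_weight pseudocharacter_countable submetrizable_T
    by blast
qed

end
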